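(* Let $\rho:[t_0,\infty)\to M_n$ be a solution of the noncommutative Ricci flow $\frac{d}{dt}\rho(t)=-\triangle\log\rho(t)$ such that $\rho(t_0)$ is strictly positive with $\tau(\rho(t_0))=1$ (so $\rho(t)$ is a strictly positive density matrix for all $t\ge t_0$). Let $S(t)=-\tau(\rho(t)\log\rho(t))$ be the von Neumann entropy. Then either $\rho(t)=\frac1n 1$ for all $t$ (the maximum-entropy state, a fixed point of the flow), or $S$ is a strictly increasing function of $t$ on $[t_0,\infty)$ with $S(t)\to\log n$ as $t\to\infty$.
   Context: Let $n\ge 2$, let $m\in\{1,\dots,n-1\}$ be relatively prime to $n$, and set $q=e^{2\pi i m/n}$. Let $M_n$ be the algebra of complex $n\times n$ matrices with identity $1$. Let $u=\mathrm{diag}(1,q,\dots,q^{n-1})$ and let $v$ be the cyclic shift matrix with $v_{j,j+1}=1$ for $j=1,\dots,n-1$, $v_{n,1}=1$, other entries $0$. Let $x,y$ be any Hermitian matrices with $u=e^{\frac{2\pi i}{n}x}$ and $v=e^{\frac{2\pi i}{n}y}$. Define $\delta_1(a)=[y,a]$, $\delta_2(a)=-[x,a]$ and $\triangle=\delta_1^2+\delta_2^2$ on $M_n$. $\tau$ is the usual trace; $\log$ of a strictly positive matrix is defined by functional calculus. A density matrix is a positive matrix of trace $1$. Existence and uniqueness of the flow on $[t_0,\infty)$ for strictly positive initial data, together with preservation of the trace, hold. *)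

theory Defs
  imports "HOL-Analysis.Analysis" "Jordan_Normal_Form.Matrix"
begin

text \<open>Matrices in M_n are complex matrices in carrier_mat n n; indices run over 0..n-1.\<close>

definition adj :: "complex mat \<Rightarrow> complex mat" where
  "adj A = mat (dim_col A) (dim_row A) (\<lambda>(i,j). cnj (A $$ (j,i)))"

definition hermitian :: "complex mat \<Rightarrow> bool" where
  "hermitian A \<longleftrightarrow> A \<in> carrier_mat (dim_row A) (dim_row A) \<and> adj A = A"

definition unitary :: "complex mat \<Rightarrow> bool" where
  "unitary U \<longleftrightarrow> U \<in> carrier_mat (dim_row U) (dim_row U) \<and> adj U * U = 1\<^sub>m (dim_row U)"

definition positive_mat :: "complex mat \<Rightarrow> bool" where
  "positive_mat A \<longleftrightarrow> hermitian A \<and>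
     (\<forall>v \<in> carrier_vec (dim_row A). 0 \<le> Re (\<Sum>i<dim_row A. cnj (v $ i) * (A *\<^sub>v v) $ i))"

definition strictly_positive :: "complex mat \<Rightarrow> bool" where
  "strictly_positive A \<longleftrightarrow> positive_mat A \<and> invertible_mat A"

definition tr :: "complex mat \<Rightarrow> complex" where
  "tr A = (\<Sum>i<dim_row A. A $$ (i,i))"

definition fcalc :: "(real \<Rightarrow> complex) \<Rightarrow> complex mat \<Rightarrow> complex mat" where
  "fcalc f A = (SOME B. \<exists>U d. U \<in> carrier_mat (dim_row A) (dim_row A) \<and> unitary U \<and>
       A = U * mat_diag (dim_row A) (\<lambda>i. complex_of_real (d i)) * adj U \<and>
       B = U * mat_diag (dim_row A) (\<lambda>i. f (d i)) * adj U)"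

definition mlog :: "complex mat \<Rightarrow> complex mat" where
  "mlog A = fcalc (\<lambda>t. complex_of_real (ln t)) A"

definition mexp_i :: "real \<Rightarrow> complex mat \<Rightarrow> complex mat" where
  "mexp_i c A = fcalc (\<lambda>t. exp (\<i> * complex_of_real (c * t))) A"

definition clock :: "nat \<Rightarrow> complex \<Rightarrow> complex mat" where
  "clock n q = mat_diag n (\<lambda>j. q ^ j)"

definition shift :: "nat \<Rightarrow> complex mat" where
  "shift n = mat n n (\<lambda>(i,j). if j = (i + 1) mod n then 1 else 0)"

definition comm :: "complex mat \<Rightarrow> complex mat \<Rightarrow> complex mat" where
  "comm a b = a * b - b * a"

definition laplacian :: "complex mat \<Rightarrow> complex mat \<Rightarrow> complex mat \<Rightarrow> complex mat" where
  "laplacian x y a = comm y (comm y a) + (- comm x (- comm x a))"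

definition vn_entropy :: "complex mat \<Rightarrow> real" where
  "vn_entropy r = - Re (tr (r * mlog r))"

end

theory Submission
  imports Defs "Jordan_Normal_Form.Schur_Decomposition" "Jordan_Normal_Form.Spectral_Radius"
    "HOL-Number_Theory.Cong" "HOL-Real_Asymp.Real_Asymp"
begin

text \<open>
  Write \<open>f = \<parallel>\<rho> - 1/n\<parallel>\<^sup>2\<close> in the Hilbert--Schmidt norm. In an eigenbasis of \<open>\<rho>\<close> with eigenvalues
  \<open>d\<^sub>i \<in> (0,1]\<close>, both \<open>S'\<close> and \<open>-f'/2\<close> are sums over \<open>i, j\<close> of \<open>|x\<^sub>i\<^sub>j|\<^sup>2 + |y\<^sub>i\<^sub>j|\<^sup>2\<close> times
  \<open>(ln d\<^sub>i - ln d\<^sub>j)\<^sup>2\<close>, respectively \<open>(d\<^sub>i - d\<^sub>j) (ln d\<^sub>i - ln d\<^sub>j)\<close>; as \<open>ln\<close> has slope at least 1 on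
  \<open>(0,1]\<close>, both dominate \<open>\<parallel>[x,\<rho>]\<parallel>\<^sup>2 + \<parallel>[y,\<rho>]\<parallel>\<^sup>2\<close>. Since \<open>exp\<close> is Lipschitz on the imaginary axis,
  this quantity controls \<open>\<parallel>[u,\<rho>]\<parallel>\<^sup>2 + \<parallel>[v,\<rho>]\<parallel>\<^sup>2\<close>, which the explicit form of clock and shift bounds
  below by a multiple of \<open>f\<close>. Hence \<open>f\<close> decays exponentially, and \<open>0 \<le> ln n - S \<le> n f\<close> gives the limit.
  Strict monotonicity needs \<open>f > 0\<close> throughout: near \<open>1/n\<close> one also has \<open>f' \<ge> - k f\<close>, so \<open>f\<close> cannot
  reach 0 in finite time unless it vanishes identically. That \<open>S\<close> is differentiable follows, without
  differentiating eigenvalues, from a two-sided version of Klein's inequality whose error is quadratic.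
\<close>

section \<open>Adjoints, traces and the Hilbert--Schmidt norm\<close>

lemma adj_carrier [simp]: "A \<in> carrier_mat r c \<Longrightarrow> adj A \<in> carrier_mat c r"
  by (auto simp: adj_def)

lemma adj_index [simp]:
  "i < dim_col A \<Longrightarrow> j < dim_row A \<Longrightarrow> adj A $$ (i,j) = cnj (A $$ (j,i))"
  by (simp add: adj_def)

lemma dim_adj [simp]: "dim_row (adj A) = dim_col A" "dim_col (adj A) = dim_row A"
  by (simp_all add: adj_def)

lemma adj_adj [simp]: "adj (adj A) = A"
  by (rule eq_matI) auto

lemma mult_mat_index:
  "A \<in> carrier_mat r k \<Longrightarrow> B \<in> carrier_mat k c \<Longrightarrow> i < r \<Longrightarrow> j < c \<Longrightarrow>
    (A * B) $$ (i,j) = (\<Sum>l<k. A $$ (i,l) * B $$ (l,j))"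
  by (auto simp: scalar_prod_def atLeast0LessThan intro!: sum.cong)

lemma adj_mult:
  assumes "A \<in> carrier_mat r k" "B \<in> carrier_mat k c"
  shows "adj (A * B) = adj B * adj A"
proof (rule eq_matI)
  fix i j assume "i < dim_row (adj B * adj A)" "j < dim_col (adj B * adj A)"
  then show "adj (A * B) $$ (i,j) = (adj B * adj A) $$ (i,j)"
    using assms by (auto simp: scalar_prod_def mult.commute intro!: sum.cong)
qed (use assms in auto)

lemma adj_one [simp]: "adj (1\<^sub>m n) = 1\<^sub>m n"
  by (rule eq_matI) auto

lemma hermitian_iff: "A \<in> carrier_mat n n \<Longrightarrow> hermitian A \<longleftrightarrow> adj A = A"
  by (auto simp: hermitian_def)

lemma hermitian_index:
  "hermitian A \<Longrightarrow> A \<in> carrier_mat n n \<Longrightarrow> i < n \<Longrightarrow> j < n \<Longrightarrow> A $$ (j,i) = cnj (A $$ (i,j))"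
  by (metis adj_index carrier_matD hermitian_def)

lemma unitary_inverse:
  assumes "unitary U" "U \<in> carrier_mat n n"
  shows "adj U * U = 1\<^sub>m n" "U * adj U = 1\<^sub>m n"
proof -
  show "adj U * U = 1\<^sub>m n" using assms by (auto simp: unitary_def)
  then show "U * adj U = 1\<^sub>m n"
    using mat_mult_left_right_inverse[of "adj U" n U] assms by simp
qed

lemma tr_mult_index:
  assumes "A \<in> carrier_mat n k" "B \<in> carrier_mat k n"
  shows "tr (A * B) = (\<Sum>i<n. \<Sum>l<k. A $$ (i,l) * B $$ (l,i))"
  using assms by (auto simp: tr_def mult_mat_index[of A n k B n] simp del: index_mult_mat(1))

lemma tr_mult_comm:
  assumes "A \<in> carrier_mat n k" "B \<in> carrier_mat k n"
  shows "tr (A * B) = tr (B * A)"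
proof -
  have "tr (A * B) = (\<Sum>i<n. \<Sum>l<k. A $$ (i,l) * B $$ (l,i))"
    using assms by (rule tr_mult_index)
  also have "\<dots> = (\<Sum>l<k. \<Sum>i<n. B $$ (l,i) * A $$ (i,l))"
    by (subst sum.swap) (simp add: mult.commute)
  also have "\<dots> = tr (B * A)"
    using assms by (simp add: tr_mult_index[of B k n A])
  finally show ?thesis .
qed

lemma tr_add: "A \<in> carrier_mat n n \<Longrightarrow> B \<in> carrier_mat n n \<Longrightarrow> tr (A + B) = tr A + tr B"
  by (auto simp: tr_def sum.distrib)

lemma tr_diff: "A \<in> carrier_mat n n \<Longrightarrow> B \<in> carrier_mat n n \<Longrightarrow> tr (A - B) = tr A - tr B"
  by (auto simp: tr_def sum_subtractf)

text \<open>The square of the Hilbert--Schmidt norm. It is left squared, as the flow differentiates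
  squares and the estimates below compare squares.\<close>

definition hs :: "complex mat \<Rightarrow> real" where
  "hs A = (\<Sum>i<dim_row A. \<Sum>j<dim_col A. (cmod (A $$ (i,j)))\<^sup>2)"

lemma hs_alt: "A \<in> carrier_mat r c \<Longrightarrow> hs A = (\<Sum>i<r. \<Sum>j<c. (cmod (A $$ (i,j)))\<^sup>2)"
  by (simp add: hs_def)

lemma hs_nonneg: "hs A \<ge> 0"
  by (simp add: hs_def sum_nonneg)

text \<open>Passing from entries to a trace turns unitary invariance of \<open>hs\<close> into
  cyclicity of \<open>tr\<close>.\<close>

lemma hs_tr: "complex_of_real (hs A) = tr (adj A * A)"
proof -
  have "tr (adj A * A) = (\<Sum>j<dim_col A. \<Sum>i<dim_row A. cnj (A $$ (i,j)) * A $$ (i,j))"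
    by (auto simp: tr_def scalar_prod_def atLeast0LessThan intro!: sum.cong)
  also have "\<dots> = (\<Sum>j<dim_col A. \<Sum>i<dim_row A. complex_of_real ((cmod (A $$ (i,j)))\<^sup>2))"
    by (auto simp: complex_norm_square mult.commute simp del: of_real_power intro!: sum.cong)
  finally show ?thesis
    by (subst (asm) sum.swap) (simp add: hs_def)
qed

lemma tr_conj:
  assumes "unitary U" "U \<in> carrier_mat n n" "A \<in> carrier_mat n n"
  shows "tr (adj U * A * U) = tr A"
proof -
  have "tr (adj U * A * U) = tr (U * (adj U * A))"
    using assms by (intro tr_mult_comm[of _ n n]) auto
  also have "U * (adj U * A) = (U * adj U) * A"
    using assms by (simp add: assoc_mult_mat[of _ n n _ n _ n])
  finally show ?thesis using assms by (simp add: unitary_inverse)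
qed

lemma conj_mult:
  assumes "unitary U" "U \<in> carrier_mat n n" "A \<in> carrier_mat n n" "B \<in> carrier_mat n n"
  shows "adj U * (A * B) * U = (adj U * A * U) * (adj U * B * U)"
proof -
  have "(adj U * A * U) * (adj U * B * U) = adj U * A * (U * adj U) * (B * U)"
    using assms by (simp add: assoc_mult_mat[of _ n n _ n _ n] mult_carrier_mat[of _ n n _ n])
  also have "\<dots> = adj U * (A * B) * U"
    unfolding unitary_inverse[OF assms(1,2)]
    using assms by (simp add: assoc_mult_mat[of _ n n _ n _ n] mult_carrier_mat[of _ n n _ n])
  finally show ?thesis by simp
qed

lemma adj_conj:
  assumes "U \<in> carrier_mat n n" "A \<in> carrier_mat n n"
  shows "adj (adj U * A * U) = adj U * adj A * U"
  using assms by (simp add: adj_mult[of _ n n _ n] assoc_mult_mat[of _ n n _ n _ n] mult_carrier_mat[of _ n n _ n])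

lemma hs_conj:
  assumes "unitary U" "U \<in> carrier_mat n n" "A \<in> carrier_mat n n"
  shows "hs (adj U * A * U) = hs A"
proof -
  have "complex_of_real (hs (adj U * A * U)) = tr (adj U * (adj A * A) * U)"
    unfolding hs_tr using assms by (simp add: adj_conj[of _ n] conj_mult[of U n])
  also have "\<dots> = hs A" using assms unfolding hs_tr by (intro tr_conj[of _ n]) auto
  finally show ?thesis by simp
qed

text \<open>The form in which \<open>fcalc\<close> presents its values. For unitary \<open>U\<close>
  the columns are eigenvectors shared by all choices of \<open>f\<close>, so products and traces
  reduce to sums over the spectrum.\<close>

definition udiag :: "nat \<Rightarrow> complex mat \<Rightarrow> (nat \<Rightarrow> complex) \<Rightarrow> complex mat" where
  "udiag n U f = U * mat_diag n f * adj U"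

lemma udiag_carrier [simp]: "U \<in> carrier_mat n n \<Longrightarrow> udiag n U f \<in> carrier_mat n n"
  by (simp add: udiag_def mult_carrier_mat[of _ n n _ n])

lemma udiag_conj:
  assumes "unitary U" "U \<in> carrier_mat n n"
  shows "adj U * udiag n U f * U = mat_diag n f"
proof -
  have "adj U * udiag n U f * U = (adj U * U) * mat_diag n f * (adj U * U)"
    using assms(2) by (simp add: udiag_def assoc_mult_mat[of _ n n _ n _ n] mult_carrier_mat[of _ n n _ n])
  then show ?thesis
    by (simp add: unitary_inverse[OF assms] left_mult_one_mat[of _ n n] right_mult_one_mat[of _ n n])
qed

lemma udiag_index:
  assumes "U \<in> carrier_mat n n" "i < n" "j < n"
  shows "udiag n U f $$ (i,j) = (\<Sum>k<n. U $$ (i,k) * f k * cnj (U $$ (j,k)))"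
  unfolding udiag_def using assms
  by (subst mult_mat_index[of _ n n _ n]) (auto simp: mat_diag_mult_right[of _ n] mult_carrier_mat[of _ n n _ n])

lemma udiag_mult:
  assumes "unitary U" "U \<in> carrier_mat n n"
  shows "udiag n U f * udiag n U g = udiag n U (\<lambda>i. f i * g i)"
proof -
  have "udiag n U f * udiag n U g = U * mat_diag n f * (adj U * U) * mat_diag n g * adj U"
    using assms(2) by (simp add: udiag_def assoc_mult_mat[of _ n n _ n _ n] mult_carrier_mat[of _ n n _ n])
  also have "\<dots> = U * (mat_diag n f * mat_diag n g) * adj U"
    unfolding unitary_inverse[OF assms]
    using assms(2) by (simp add: assoc_mult_mat[of _ n n _ n _ n] mult_carrier_mat[of _ n n _ n]
        left_mult_one_mat[of _ n n] del: mat_diag_diag)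
  finally show ?thesis by (simp add: udiag_def)
qed

lemma udiag_const:
  assumes "unitary U" "U \<in> carrier_mat n n"
  shows "udiag n U (\<lambda>i. c) = c \<cdot>\<^sub>m 1\<^sub>m n"
proof -
  have "mat_diag n (\<lambda>i. c) = c \<cdot>\<^sub>m 1\<^sub>m n" by (rule eq_matI) (auto simp: mat_diag_def)
  then have "udiag n U (\<lambda>i. c) = c \<cdot>\<^sub>m (U * adj U)"
    using assms by (simp add: udiag_def mult_smult_distrib[of _ n n _ n] mult_smult_assoc_mat[of _ n n _ n])
  then show ?thesis by (simp add: unitary_inverse[OF assms])
qed

section \<open>Commutators and the trace form\<close>

lemma comm_carrier [simp]: "A \<in> carrier_mat n n \<Longrightarrow> B \<in> carrier_mat n n \<Longrightarrow> comm A B \<in> carrier_mat n n"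
  unfolding comm_def by (intro minus_carrier_mat) (rule mult_carrier_mat[of _ n n], auto)

lemma tr_comm: "A \<in> carrier_mat n n \<Longrightarrow> B \<in> carrier_mat n n \<Longrightarrow> tr (comm A B) = 0"
  by (simp add: comm_def tr_diff[of _ n] mult_carrier_mat[of _ n n _ n] tr_mult_comm[of A n n B])

lemma conj_comm:
  assumes "unitary U" "U \<in> carrier_mat n n" "A \<in> carrier_mat n n" "B \<in> carrier_mat n n"
  shows "adj U * comm A B * U = comm (adj U * A * U) (adj U * B * U)"
  using assms
  by (simp add: comm_def conj_mult[of U n, symmetric] mult_minus_distrib_mat[of _ n n _ n]
      minus_mult_distrib_mat[of _ n n _ _ n] mult_carrier_mat[of _ n n _ n])

lemma comm_diag_index:
  assumes "A \<in> carrier_mat n n" "i < n" "j < n"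
  shows "comm (mat_diag n f) A $$ (i,j) = (f i - f j) * A $$ (i,j)"
  using assms by (simp add: comm_def mat_diag_mult_left[of _ n n] mat_diag_mult_right[of _ n n] algebra_simps)

text \<open>Conjugation by \<open>U\<close> preserves \<open>hs\<close> and makes the first argument
  diagonal; a commutator with a diagonal matrix scales each entry by a difference of
  eigenvalues.\<close>

lemma hs_comm_udiag:
  assumes U: "unitary U" "U \<in> carrier_mat n n" and A: "A \<in> carrier_mat n n"
  shows "hs (comm (udiag n U f) A) =
    (\<Sum>i<n. \<Sum>j<n. (cmod (f i - f j))\<^sup>2 * (cmod ((adj U * A * U) $$ (i,j)))\<^sup>2)"
proof -
  have C: "adj U * A * U \<in> carrier_mat n n" using assms by (simp add: mult_carrier_mat[of _ n n _ n])
  have "hs (comm (udiag n U f) A) = hs (adj U * comm (udiag n U f) A * U)"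
    using assms by (simp add: hs_conj[of U n])
  also have "adj U * comm (udiag n U f) A * U = comm (mat_diag n f) (adj U * A * U)"
    using assms by (simp add: conj_comm[of U n] udiag_conj)
  finally show ?thesis
    using C by (simp add: hs_alt[of _ n n] comm_diag_index norm_mult power_mult_distrib)
qed

lemma hs_comm_commute:
  assumes "A \<in> carrier_mat n n" "B \<in> carrier_mat n n"
  shows "hs (comm A B) = hs (comm B A)"
proof -
  have "cmod (comm A B $$ (i,j)) = cmod (comm B A $$ (i,j))" if "i < n" "j < n" for i j
    using that assms by (simp add: comm_def norm_minus_commute)
  then show ?thesis using assms by (simp add: hs_alt[of _ n n])
qed

text \<open>The trace form is invariant under commutators, by cyclicity. This serves as integration
  by parts for the derivations.\<close>

lemma tr_mult_comm_shift:
  assumes "A \<in> carrier_mat n n" "B \<in> carrier_mat n n" "C \<in> carrier_mat n n"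
  shows "tr (A * comm B C) = tr (comm A B * C)"
proof -
  have "tr (A * comm B C) = tr (A * (B * C)) - tr (A * (C * B))"
    using assms by (simp add: comm_def mult_minus_distrib_mat[of _ n n _ n] tr_diff[of _ n] mult_carrier_mat[of _ n n _ n])
  also have "tr (A * (C * B)) = tr ((A * C) * B)"
    using assms by (simp add: assoc_mult_mat[of _ n n _ n _ n])
  also have "\<dots> = tr (B * (A * C))"
    using assms by (intro tr_mult_comm[of _ n n] mult_carrier_mat[of _ n n])
  finally show ?thesis
    using assms by (simp add: comm_def minus_mult_distrib_mat[of _ n n _ _ n] tr_diff[of _ n]
        mult_carrier_mat[of _ n n _ n] assoc_mult_mat[of _ n n _ n _ n])
qed

text \<open>One commutator is moved to the other factor, after which both scale the entries of
  \<open>z\<close>, taken in the basis \<open>U\<close>, by eigenvalue differences; hermiticity of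
  \<open>z\<close> pairs opposite entries into a squared modulus. With \<open>ln\<close> of the
  eigenvalues as \<open>g\<close> this computes both \<open>S'\<close> and
  \<open>f'\<close>.\<close>

lemma tr_udiag_comm_comm:
  fixes f g :: "nat \<Rightarrow> real"
  assumes U: "unitary U" "U \<in> carrier_mat n n" and z: "hermitian z" "z \<in> carrier_mat n n"
  shows "tr (udiag n U f * comm z (comm z (udiag n U g))) =
    (\<Sum>i<n. \<Sum>j<n. (cmod ((adj U * z * U) $$ (i,j)))\<^sup>2 * ((f i - f j) * (g i - g j)))"
proof -
  define Z where "Z = adj U * z * U"
  have Z: "Z \<in> carrier_mat n n" using assms by (simp add: Z_def mult_carrier_mat[of _ n n _ n])
  have hZ: "hermitian Z"
    using adj_conj[OF U(2) z(2)] z unfolding hermitian_iff[OF Z] by (simp add: Z_def hermitian_def)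
  let ?a = "udiag n U f" and ?b = "udiag n U g"
  have "tr (?a * comm z (comm z ?b)) = tr (comm ?a z * comm z ?b)"
    using assms by (intro tr_mult_comm_shift[of _ n]) auto
  also have "\<dots> = tr (adj U * (comm ?a z * comm z ?b) * U)"
    using assms by (intro tr_conj[symmetric, of _ n]) (auto intro!: mult_carrier_mat[of _ n n])
  also have "\<dots> = tr (comm (mat_diag n f) Z * comm Z (mat_diag n g))"
    using assms by (simp add: conj_mult[of U n] conj_comm[of U n] udiag_conj Z_def)
  also have "\<dots> = (\<Sum>i<n. \<Sum>j<n. comm (mat_diag n f) Z $$ (i,j) * comm Z (mat_diag n g) $$ (j,i))"
    using Z by (intro tr_mult_index comm_carrier) auto
  also have "\<dots> = (\<Sum>i<n. \<Sum>j<n. (cmod (Z $$ (i,j)))\<^sup>2 * ((f i - f j) * (g i - g j)))"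
    unfolding of_real_sum
  proof (intro sum.cong refl)
    fix i j assume "i \<in> {..<n}" "j \<in> {..<n}"
    then have ij: "i < n" "j < n" by auto
    \<comment> \<open>The order inside the commutator and the order of the indices are both
      reversed, so the two signs cancel and the difference is again \<open>i\<close> minus
      \<open>j\<close>.\<close>
    have "comm Z (mat_diag n g) $$ (j,i) = (g i - g j) * Z $$ (j,i)"
      using Z ij by (simp add: comm_def mat_diag_mult_left[of _ n n] mat_diag_mult_right[of _ n n] algebra_simps)
    then have "comm (mat_diag n f) Z $$ (i,j) * comm Z (mat_diag n g) $$ (j,i) =
        complex_of_real ((f i - f j) * (g i - g j)) * (Z $$ (i,j) * cnj (Z $$ (i,j)))"
      using ij Z hermitian_index[OF hZ Z ij] by (simp add: comm_diag_index)
    then show "comm (mat_diag n f) Z $$ (i,j) * comm Z (mat_diag n g) $$ (j,i) =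
      complex_of_real ((cmod (Z $$ (i,j)))\<^sup>2 * ((f i - f j) * (g i - g j)))"
      by (simp only: of_real_mult complex_norm_square mult.commute)
  qed
  finally show ?thesis by (simp add: Z_def)
qed

text \<open>Transition probabilities between two orthonormal bases, the columns of \<open>U\<close>
  and of \<open>V\<close>. They form a doubly stochastic matrix, which lets two matrices that need
  not commute be compared through pairs of scalars.\<close>

definition overlap :: "complex mat \<Rightarrow> complex mat \<Rightarrow> nat \<Rightarrow> nat \<Rightarrow> real" where
  "overlap U V i j = (cmod ((adj U * V) $$ (i,j)))\<^sup>2"

text \<open>Conjugation by \<open>U\<close> makes the first factor diagonal and leaves the basis
  change \<open>adj U * V\<close> in the second; a trace against a diagonal matrix sees only the
  diagonal, hence only squared moduli.\<close>

lemma tr_udiag_udiag: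
  fixes f g :: "nat \<Rightarrow> real"
  assumes U: "unitary U" "U \<in> carrier_mat n n" and V: "unitary V" "V \<in> carrier_mat n n"
  shows "tr (udiag n U f * udiag n V g) = (\<Sum>i<n. \<Sum>j<n. overlap U V i j * (f i * g j))"
proof -
  define W where "W = adj U * V"
  have W: "W \<in> carrier_mat n n" using assms by (simp add: W_def mult_carrier_mat[of _ n n _ n])
  have "adj U * udiag n V g * U = udiag n W g"
    using assms by (simp add: udiag_def W_def adj_mult[of _ n n _ n] assoc_mult_mat[of _ n n _ n _ n] mult_carrier_mat[of _ n n _ n])
  then have "tr (udiag n U f * udiag n V g) = tr (mat_diag n f * udiag n W g)"
    using assms conj_mult[OF U, of "udiag n U f" "udiag n V g"]
      tr_conj[OF U, of "udiag n U f * udiag n V g"]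
    by (simp add: udiag_conj mult_carrier_mat[of _ n n _ n])
  also have "\<dots> = (\<Sum>i<n. f i * (\<Sum>k<n. W $$ (i,k) * g k * cnj (W $$ (i,k))))"
    using W by (simp add: tr_def mat_diag_mult_left[of _ n n] udiag_index)
  also have "\<dots> = (\<Sum>i<n. \<Sum>j<n. overlap U V i j * (f i * g j))"
    unfolding overlap_def W_def[symmetric]
    by (simp add: sum_distrib_left complex_norm_square algebra_simps del: of_real_power)
  finally show ?thesis .
qed

lemma overlap_nonneg: "overlap U V i j \<ge> 0"
  by (simp add: overlap_def)

text \<open>The sum is a diagonal entry of \<open>W * adj W\<close> for the unitary
  \<open>W = adj U * V\<close>.\<close>

lemma overlap_row_sum:
  assumes U: "unitary U" "U \<in> carrier_mat n n" and V: "unitary V" "V \<in> carrier_mat n n" and i: "i < n"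
  shows "(\<Sum>j<n. overlap U V i j) = 1"
proof -
  define W where "W = adj U * V"
  have W: "W \<in> carrier_mat n n" using assms by (simp add: W_def mult_carrier_mat[of _ n n _ n])
  have "W * adj W = adj U * (V * adj V) * U"
    using assms(2,4) by (simp add: W_def adj_mult[of _ n n _ n] assoc_mult_mat[of _ n n _ n _ n] mult_carrier_mat[of _ n n _ n])
  also have "\<dots> = 1\<^sub>m n" using U V by (simp add: unitary_inverse)
  finally have "(W * adj W) $$ (i,i) = 1" using i by simp
  then have "(\<Sum>j<n. complex_of_real ((cmod (W $$ (i,j)))\<^sup>2)) = 1"
    using W i by (simp add: mult_mat_index[of _ n n _ n] complex_norm_square del: of_real_power index_mult_mat(1))
  then show ?thesis unfolding overlap_def W_def[symmetric]
    by (metis of_real_eq_1_iff of_real_sum)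
qed

lemma overlap_sym:
  assumes "U \<in> carrier_mat n n" "V \<in> carrier_mat n n" "i < n" "j < n"
  shows "overlap U V i j = overlap V U j i"
proof -
  have "adj V * U = adj (adj U * V)" using assms by (simp add: adj_mult[of _ n n _ n])
  then show ?thesis using assms by (simp add: overlap_def del: index_mult_mat(1))
qed

lemma overlap_col_sum:
  assumes U: "unitary U" "U \<in> carrier_mat n n" and V: "unitary V" "V \<in> carrier_mat n n" and j: "j < n"
  shows "(\<Sum>i<n. overlap U V i j) = 1"
proof -
  have "(\<Sum>i<n. overlap U V i j) = (\<Sum>i<n. overlap V U j i)"
    using assms by (intro sum.cong) (auto intro: overlap_sym)
  then show ?thesis using overlap_row_sum[OF V U j] by simp
qed

section \<open>Diagonalization of Hermitian matrices\<close>

lemma udiag_unitary_mult: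
  assumes "W \<in> carrier_mat n n" "Q \<in> carrier_mat n n"
  shows "udiag n (W * Q) f = W * udiag n Q f * adj W"
  using assms
  by (simp add: udiag_def adj_mult[of _ n n _ n] assoc_mult_mat[of _ n n _ n _ n] mult_carrier_mat[of _ n n _ n])

lemma unitary_mult:
  assumes W: "unitary W" "W \<in> carrier_mat n n" and Q: "unitary Q" "Q \<in> carrier_mat n n"
  shows "unitary (W * Q)"
proof -
  have "adj (W * Q) * (W * Q) = adj Q * (adj W * W) * Q"
    using W(2) Q(2)
    by (simp add: adj_mult[of _ n n _ n] assoc_mult_mat[of _ n n _ n _ n] mult_carrier_mat[of _ n n _ n])
  also have "\<dots> = 1\<^sub>m n" using Q by (simp add: unitary_inverse[OF W] unitary_inverse)
  finally show ?thesis using W(2) Q(2) by (simp add: unitary_def)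
qed

text \<open>A basis that starts with \<open>v\<close> is orthogonalized by Gram--Schmidt, which
  keeps its first vector. Dividing each vector by its length \<open>s j\<close> gives the columns of
  \<open>W\<close>, hence the scalar \<open>c\<close>.\<close>

lemma unitary_completion:
  assumes v: "v \<in> carrier_vec n" "v \<noteq> 0\<^sub>v n"
  obtains W :: "complex mat" and c where "W \<in> carrier_mat n n" "unitary W" "col W 0 = c \<cdot>\<^sub>v v"
proof -
  interpret cof_vec_space n "TYPE(complex)" .
  define b where "b = basis_completion v"
  define ws where "ws = gram_schmidt n b"
  have b: "span (set b) = carrier_vec n" "distinct b" "\<not> lin_dep (set b)"
    "set b \<subseteq> carrier_vec n" "hd b = v" "length b = n"
    using basis_completion[OF v] unfolding b_def by auto
  from gram_schmidt_result[OF b(4,2,3) ws_def]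
  have ws: "set ws \<subseteq> carrier_vec n" "corthogonal ws" "length ws = n" by (auto simp: b)
  have n: "n > 0" using v by (cases n) auto
  obtain vs where "b = v # vs" using b n by (cases b) auto
  then have hd_ws: "hd ws = v" using gram_schmidt_hd[OF v(1), of vs] by (simp add: ws_def)
  then have ws0: "ws ! 0 = v" using n ws(3) by (cases ws) auto
  have wsc: "ws ! j \<in> carrier_vec n" if "j < n" for j using that ws by auto
  define s where "s j = complex_of_real (sqrt (\<Sum>k<n. (cmod (ws ! j $ k))\<^sup>2))" for j
  have cprod: "ws ! j \<bullet>c ws ! i = (\<Sum>k<n. cnj (ws ! i $ k) * ws ! j $ k)" if "i < n" "j < n" for i j
    using wsc[OF that(1)] wsc[OF that(2)]
    by (auto simp: scalar_prod_def atLeast0LessThan conjugate_complex_def mult.commute intro!: sum.cong)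
  have s2: "s j * s j = (\<Sum>k<n. cnj (ws ! j $ k) * ws ! j $ k)" for j
  proof -
    have "s j * s j = complex_of_real (\<Sum>k<n. (cmod (ws ! j $ k))\<^sup>2)"
      unfolding s_def of_real_mult[symmetric] by (simp add: sum_nonneg del: of_real_sum)
    then show ?thesis by (simp add: complex_norm_square mult.commute del: of_real_power)
  qed
  define W where "W = mat n n (\<lambda>(i,j). ws ! j $ i / s j)"
  have W: "W \<in> carrier_mat n n" by (simp add: W_def)
  have "adj W * W = 1\<^sub>m n"
  proof (rule eq_matI)
    fix i j assume "i < dim_row (1\<^sub>m n :: complex mat)" "j < dim_col (1\<^sub>m n :: complex mat)"
    then have ij: "i < n" "j < n" by auto
    have "cnj (s i) = s i" by (simp add: s_def)
    then have "(adj W * W) $$ (i,j) = (ws ! j \<bullet>c ws ! i) / (s i * s j)"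
      using ij W by (simp add: cprod mult_mat_index[of _ n n _ n] sum_divide_distrib del: index_mult_mat(1))
        (simp add: W_def)
    also have "\<dots> = (1\<^sub>m n :: complex mat) $$ (i,j)"
    proof (cases "i = j")
      case True
      then have "ws ! j \<bullet>c ws ! i \<noteq> 0" using corthogonalD[OF ws(2), of j i] ij ws(3) by simp
      then show ?thesis using True ij by (simp add: cprod s2)
    next
      case False
      then have "ws ! j \<bullet>c ws ! i = 0" using corthogonalD[OF ws(2), of j i] ij ws(3) by simp
      then show ?thesis using False ij by simp
    qed
    finally show "(adj W * W) $$ (i,j) = (1\<^sub>m n :: complex mat) $$ (i,j)" .
  qed (use W in auto)
  then have "unitary W" using W by (simp add: unitary_def)
  moreover have "col W 0 = (1 / s 0) \<cdot>\<^sub>v v"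
    using n v ws0 by (intro eq_vecI) (auto simp: W_def)
  ultimately show ?thesis using that W by blast
qed

text \<open>Deflation: in a unitary basis whose first vector is an eigenvector, the first column of
  the matrix is \<open>e\<close> followed by zeros. Hermiticity copies the zeros to the first row
  and makes \<open>e\<close> real; the induction hypothesis treats the remaining block
  \<open>C\<close>.\<close>

theorem hermitian_diagonalization:
  assumes "A \<in> carrier_mat n n" "hermitian A"
  shows "\<exists>U d. U \<in> carrier_mat n n \<and> unitary U \<and> A = udiag n U (\<lambda>i. complex_of_real (d i))"
  using assms
proof (induction n arbitrary: A)
  case 0
  then have "A = udiag 0 (1\<^sub>m 0) (\<lambda>i. complex_of_real 0)"
    by (intro eq_matI) (auto simp: udiag_def)
  moreover have "unitary (1\<^sub>m 0)" by (simp add: unitary_def)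
  ultimately show ?case by (intro exI[of _ "1\<^sub>m 0"] exI[of _ "\<lambda>i. 0"]) simp
next
  case (Suc n)
  let ?N = "Suc n"
  have A: "A \<in> carrier_mat ?N ?N" "hermitian A" using Suc.prems by auto
  obtain e where "eigenvalue A e" using spectrum_non_empty[OF A(1)] by (auto simp: spectrum_def)
  then obtain v where v: "v \<in> carrier_vec ?N" "v \<noteq> 0\<^sub>v ?N" "A *\<^sub>v v = e \<cdot>\<^sub>v v"
    using A by (auto simp: eigenvalue_def eigenvector_def)
  obtain W c where W: "W \<in> carrier_mat ?N ?N" "unitary W" and col: "col W 0 = c \<cdot>\<^sub>v v"
    using unitary_completion[OF v(1,2)] by metis
  define B where "B = adj W * A * W"
  have B: "B \<in> carrier_mat ?N ?N" using A W by (simp add: B_def mult_carrier_mat[of _ ?N ?N _ ?N])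
  have hB: "hermitian B"
    using adj_conj[OF W(1) A(1)] A unfolding hermitian_iff[OF B] by (simp add: B_def hermitian_def)
  have eigen: "(A * W) $$ (k,0) = e * W $$ (k,0)" if "k < ?N" for k
  proof -
    have "(A * W) $$ (k,0) = (A *\<^sub>v col W 0) $ k" using A W that by simp
    also have "A *\<^sub>v col W 0 = e \<cdot>\<^sub>v col W 0"
      using A v by (simp add: col mult_mat_vec[of _ ?N ?N] smult_smult_assoc mult.commute)
    finally show ?thesis using W that by simp
  qed
  have B0: "B $$ (i,0) = (if i = 0 then e else 0)" if "i < ?N" for i
  proof -
    have "B $$ (i,0) = (adj W * (A * W)) $$ (i,0)"
      using A W by (simp add: B_def assoc_mult_mat[of _ ?N ?N _ ?N _ ?N])
    also have "\<dots> = (\<Sum>k<?N. adj W $$ (i,k) * (A * W) $$ (k,0))"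
      using A W that by (intro mult_mat_index[of _ ?N ?N _ ?N]) (auto intro: mult_carrier_mat[of _ ?N ?N])
    also have "\<dots> = e * (\<Sum>k<?N. adj W $$ (i,k) * W $$ (k,0))"
      unfolding sum_distrib_left by (intro sum.cong) (auto simp: eigen simp del: index_mult_mat(1))
    also have "(\<Sum>k<?N. adj W $$ (i,k) * W $$ (k,0)) = (adj W * W) $$ (i,0)"
      using W that by (intro mult_mat_index[of _ ?N ?N _ ?N, symmetric]) auto
    also have "adj W * W = 1\<^sub>m ?N" using W by (simp add: unitary_inverse)
    finally show ?thesis using that by simp
  qed
  have B0': "B $$ (0,i) = 0" if "i < ?N" "i \<noteq> 0" for i
    using B0[OF that(1)] that hermitian_index[OF hB B, of i 0] by simp
  have "cnj e = e" using B0[of 0] hermitian_index[OF hB B, of 0 0] by simp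
  then have e: "complex_of_real (Re e) = e" by (simp add: complex_eq_iff)
  define C where "C = mat n n (\<lambda>(i,j). B $$ (Suc i, Suc j))"
  have C: "C \<in> carrier_mat n n" by (simp add: C_def)
  have "hermitian C"
    unfolding hermitian_iff[OF C]
    by (intro eq_matI) (auto simp: C_def intro!: hermitian_index[OF hB B, symmetric])
  then obtain P d where P: "P \<in> carrier_mat n n" "unitary P" and CP: "C = udiag n P (\<lambda>i. complex_of_real (d i))"
    using Suc.IH[OF C] by blast
  \<comment> \<open>The block matrix with blocks 1 and \<open>P\<close>, which fixes the eigenvector
    already found.\<close>
  define Q where "Q = mat ?N ?N (\<lambda>(i,j). case (i,j) of
      (Suc i, Suc j) \<Rightarrow> P $$ (i,j) | (i,j) \<Rightarrow> if i = j then 1 else 0)"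
  define d' where "d' = case_nat (Re e) d"
  have Q: "Q \<in> carrier_mat ?N ?N" by (simp add: Q_def)
  have "adj Q * Q = 1\<^sub>m ?N"
  proof (rule eq_matI)
    fix i j assume "i < dim_row (1\<^sub>m ?N :: complex mat)" "j < dim_col (1\<^sub>m ?N :: complex mat)"
    then have ij: "i < ?N" "j < ?N" by auto
    have P1: "(\<Sum>k<n. cnj (P $$ (k,i)) * P $$ (k,j)) = (if i = j then 1 else 0)" if "i < n" "j < n" for i j
      using arg_cong[OF unitary_inverse(1)[OF P(2,1)], of "\<lambda>M. M $$ (i,j)"] that P
      by (simp add: mult_mat_index[of _ n n _ n] del: index_mult_mat(1))
    have "(adj Q * Q) $$ (i,j) = (\<Sum>k<?N. cnj (Q $$ (k,i)) * Q $$ (k,j))"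
      using Q ij by (simp add: mult_mat_index[of _ ?N ?N _ ?N] del: index_mult_mat(1) sum.lessThan_Suc)
    also have "\<dots> = (1\<^sub>m ?N :: complex mat) $$ (i,j)"
      using ij P1 unfolding sum.lessThan_Suc_shift
      by (cases i; cases j) (auto simp: Q_def)
    finally show "(adj Q * Q) $$ (i,j) = (1\<^sub>m ?N :: complex mat) $$ (i,j)" .
  qed (use Q in auto)
  then have uQ: "unitary Q" using Q by (simp add: unitary_def)
  have BQ: "B = udiag ?N Q (\<lambda>i. complex_of_real (d' i))"
  proof (rule eq_matI)
    fix i j assume "i < dim_row (udiag ?N Q (\<lambda>i. complex_of_real (d' i)))"
      "j < dim_col (udiag ?N Q (\<lambda>i. complex_of_real (d' i)))"
    then have ij: "i < ?N" "j < ?N" using Q by (auto simp: udiag_def)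
    have CPi: "B $$ (Suc i, Suc j) = (\<Sum>k<n. P $$ (i,k) * d k * cnj (P $$ (j,k)))" if "i < n" "j < n" for i j
      using arg_cong[OF CP, of "\<lambda>M. M $$ (i,j)"] that P by (simp add: udiag_index C_def)
    show "B $$ (i,j) = udiag ?N Q (\<lambda>i. complex_of_real (d' i)) $$ (i,j)"
      unfolding udiag_index[OF Q ij] sum.lessThan_Suc_shift
      using ij CPi B0 B0' e by (cases i; cases j) (auto simp: Q_def d'_def)
  qed (use B Q in \<open>auto simp: udiag_def\<close>)
  have "A = W * B * adj W"
  proof -
    have "W * B * adj W = (W * adj W) * A * (W * adj W)"
      using A W(1) by (simp add: B_def assoc_mult_mat[of _ ?N ?N _ ?N _ ?N] mult_carrier_mat[of _ ?N ?N _ ?N])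
    then show ?thesis
      using A unfolding unitary_inverse[OF W(2,1)] by simp
  qed
  then have "A = udiag ?N (W * Q) (\<lambda>i. complex_of_real (d' i))"
    using W Q by (simp add: udiag_unitary_mult BQ)
  moreover have "unitary (W * Q)" using unitary_mult[OF W(2,1) uQ Q] .
  moreover have "W * Q \<in> carrier_mat ?N ?N" using W Q by simp
  ultimately show ?case by blast
qed

section \<open>Functional calculus and the spectral gap\<close>

text \<open>Diagonalizability makes the choice in \<open>fcalc\<close> range over a nonempty set, so
  the chosen value comes with a pair \<open>U\<close>, \<open>d\<close> that represents it together
  with \<open>A\<close>. The pair may depend on \<open>f\<close>.\<close>

lemma fcalc_diagonalization:
  assumes "A \<in> carrier_mat n n" "hermitian A"
  obtains U d where "U \<in> carrier_mat n n" "unitary U"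
    "A = udiag n U (\<lambda>i. complex_of_real (d i))" "fcalc f A = udiag n U (\<lambda>i. f (d i))"
proof -
  have n: "dim_row A = n" using assms by simp
  define P where "P B \<longleftrightarrow> (\<exists>U d. U \<in> carrier_mat n n \<and> unitary U \<and>
       A = udiag n U (\<lambda>i. complex_of_real (d i)) \<and> B = udiag n U (\<lambda>i. f (d i)))" for B
  have "\<exists>B. P B" unfolding P_def using hermitian_diagonalization[OF assms] by blast
  then have "P (SOME B. P B)" by (rule someI_ex)
  moreover have "fcalc f A = (SOME B. P B)" unfolding fcalc_def P_def udiag_def n ..
  ultimately show ?thesis using that unfolding P_def by metis
qed

lemma udiag_mult_right:
  assumes "unitary U" "U \<in> carrier_mat n n"
  shows "udiag n U f * U = U * mat_diag n f"
proof -
  have "udiag n U f * U = U * mat_diag n f * (adj U * U)"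
    using assms(2) by (simp add: udiag_def assoc_mult_mat[of _ n n _ n _ n] mult_carrier_mat[of _ n n _ n])
  then show ?thesis
    using assms by (simp add: unitary_inverse[OF assms] right_mult_one_mat[of _ n n] mult_carrier_mat[of _ n n _ n])
qed

lemma unitary_col_norm:
  assumes "unitary U" "U \<in> carrier_mat n n" "i < n"
  shows "(\<Sum>k<n. cnj (U $$ (k,i)) * U $$ (k,i)) = 1"
  using arg_cong[OF unitary_inverse(1)[OF assms(1,2)], of "\<lambda>M. M $$ (i,i)"] assms
  by (simp add: mult_mat_index[of _ n n _ n] del: index_mult_mat(1))

text \<open>The quadratic form at column \<open>i\<close> of \<open>U\<close> equals
  \<open>d i\<close>, which is therefore nonnegative. If it were 0, column \<open>i\<close> of
  \<open>A * U\<close> would vanish, and applying an inverse of \<open>A\<close> would annihilate a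
  column of norm 1.\<close>

lemma strictly_positive_eigenvalue_pos:
  assumes U: "unitary U" "U \<in> carrier_mat n n"
    and A: "A = udiag n U (\<lambda>i. complex_of_real (d i))" "strictly_positive A" and i: "i < n"
  shows "d i > 0"
proof -
  have Ac: "A \<in> carrier_mat n n" using A U by simp
  have AU: "(A * U) $$ (k,i) = U $$ (k,i) * d i" if "k < n" for k
    using that i U unfolding A(1) udiag_mult_right[OF U] by (simp add: mat_diag_mult_right[of _ n])
  have "(\<Sum>k<n. cnj (col U i $ k) * (A *\<^sub>v col U i) $ k) =
      (\<Sum>k<n. cnj (U $$ (k,i)) * (U $$ (k,i) * d i))"
    using AU Ac U i by (intro sum.cong) auto
  also have "\<dots> = (\<Sum>k<n. cnj (U $$ (k,i)) * U $$ (k,i)) * d i"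
    by (simp add: sum_distrib_right mult.assoc)
  also have "\<dots> = d i" using unitary_col_norm[OF U i] by simp
  finally have q: "(\<Sum>k<n. cnj (col U i $ k) * (A *\<^sub>v col U i) $ k) = d i" .
  have "col U i \<in> carrier_vec n" using U by (intro carrier_vecI) simp
  then have "0 \<le> Re (\<Sum>k<n. cnj (col U i $ k) * (A *\<^sub>v col U i) $ k)"
    using A(2) Ac unfolding strictly_positive_def positive_mat_def by (metis carrier_matD(1))
  then have "d i \<ge> 0" unfolding q by simp
  moreover have "d i \<noteq> 0"
  proof
    assume d0: "d i = 0"
    obtain B where "inverts_mat A B" "inverts_mat B A"
      using A(2) by (auto simp: strictly_positive_def invertible_mat_def)
    then have AB: "A * B = 1\<^sub>m n" and BA: "B * A = 1\<^sub>m (dim_row B)"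
      using Ac by (auto simp: inverts_mat_def)
    \<comment> \<open>\<open>inverts_mat\<close> leaves the shape of \<open>B\<close> open; the
      dimensions of the two products determine it.\<close>
    have "dim_col (A * B) = n" "dim_col (B * A) = dim_row B" unfolding AB BA by simp_all
    then have B: "B \<in> carrier_mat n n" using Ac by auto
    have "U = (B * A) * U" using BA B U by simp
    also have "\<dots> = B * (A * U)" using B Ac U by (simp add: assoc_mult_mat[of _ n n _ n _ n])
    finally have UB: "U = B * (A * U)" .
    have "U $$ (k,i) = 0" if "k < n" for k
    proof -
      have "(B * (A * U)) $$ (k,i) = (\<Sum>l<n. B $$ (k,l) * (A * U) $$ (l,i))"
        using B Ac U i that by (intro mult_mat_index[of _ n n _ n] mult_carrier_mat[of _ n n _ n]) auto
      also have "\<dots> = 0" using AU d0 by (intro sum.neutral) (auto simp del: index_mult_mat(1))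
      finally show ?thesis using UB by metis
    qed
    then show False using unitary_col_norm[OF U i] by simp
  qed
  ultimately show ?thesis by simp
qed

lemma strictly_positive_diagonalization:
  assumes "A \<in> carrier_mat n n" "strictly_positive A"
  obtains U d where "U \<in> carrier_mat n n" "unitary U"
    "A = udiag n U (\<lambda>i. complex_of_real (d i))" "mlog A = udiag n U (\<lambda>i. complex_of_real (ln (d i)))"
    "\<And>i. i < n \<Longrightarrow> d i > 0"
proof -
  have "hermitian A" using assms by (simp add: strictly_positive_def positive_mat_def)
  from fcalc_diagonalization[OF assms(1) this, where f = "\<lambda>t. complex_of_real (ln t)"]
  obtain U d where "U \<in> carrier_mat n n" "unitary U"
    "A = udiag n U (\<lambda>i. complex_of_real (d i))" "mlog A = udiag n U (\<lambda>i. complex_of_real (ln (d i)))"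
    unfolding mlog_def by metis
  with that strictly_positive_eigenvalue_pos assms show ?thesis by metis
qed

text \<open>A chord of the unit circle, of length twice the sine of half the angle, is at most as
  long as its arc.\<close>

lemma exp_i_lipschitz: "cmod (exp (\<i> * complex_of_real s) - exp (\<i> * complex_of_real t)) \<le> \<bar>s - t\<bar>"
proof -
  have "exp (\<i> * complex_of_real s) - exp (\<i> * complex_of_real t) =
      exp (\<i> * complex_of_real t) * (exp (\<i> * complex_of_real (s - t)) - 1)"
    by (simp add: algebra_simps exp_add[symmetric])
  then have "cmod (exp (\<i> * complex_of_real s) - exp (\<i> * complex_of_real t)) =
      2 * \<bar>sin ((s - t) / 2)\<bar>"
    by (simp only: norm_mult norm_exp_i_times dist_exp_i_1 mult_1)
  also have "\<dots> \<le> \<bar>s - t\<bar>" using abs_sin_x_le_abs_x[of "(s - t) / 2"] by simp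
  finally show ?thesis .
qed

text \<open>In an eigenbasis of \<open>x\<close> both commutators scale the same entries of
  \<open>a\<close>, so the Lipschitz bound applies entry by entry. It passes from an arbitrary
  Hermitian logarithm to the explicit clock and shift.\<close>

lemma hs_comm_mexp_i_le:
  assumes x: "x \<in> carrier_mat n n" "hermitian x" and a: "a \<in> carrier_mat n n"
  shows "hs (comm (mexp_i c x) a) \<le> c\<^sup>2 * hs (comm x a)"
proof -
  obtain U d where U: "U \<in> carrier_mat n n" "unitary U"
    and xU: "x = udiag n U (\<lambda>i. complex_of_real (d i))"
    and eU: "mexp_i c x = udiag n U (\<lambda>i. exp (\<i> * complex_of_real (c * d i)))"
    using fcalc_diagonalization[OF x, where f = "\<lambda>t. exp (\<i> * complex_of_real (c * t))"]
    unfolding mexp_i_def by blast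
  have "(cmod (exp (\<i> * complex_of_real (c * d i)) - exp (\<i> * complex_of_real (c * d j))))\<^sup>2
      \<le> c\<^sup>2 * (cmod (complex_of_real (d i) - complex_of_real (d j)))\<^sup>2" for i j
  proof -
    have "cmod (exp (\<i> * complex_of_real (c * d i)) - exp (\<i> * complex_of_real (c * d j))) \<le> \<bar>c * (d i - d j)\<bar>"
      using exp_i_lipschitz[of "c * d i" "c * d j"] by (simp add: right_diff_distrib)
    then have "(cmod (exp (\<i> * complex_of_real (c * d i)) - exp (\<i> * complex_of_real (c * d j))))\<^sup>2 \<le> \<bar>c * (d i - d j)\<bar>\<^sup>2"
      by (intro power_mono) auto
    then show ?thesis by (simp add: power_mult_distrib norm_of_real flip: of_real_diff)
  qed
  then show ?thesis
    unfolding eU unfolding xU hs_comm_udiag[OF U(2,1) a] sum_distrib_left mult.assoc[symmetric]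
    by (intro sum_mono mult_right_mono) auto
qed

section \<open>The spectral gap of clock and shift\<close>

lemma hs_entry_le:
  assumes "A \<in> carrier_mat r c" "i < r" "j < c"
  shows "(cmod (A $$ (i,j)))\<^sup>2 \<le> hs A"
proof -
  have "(cmod (A $$ (i,j)))\<^sup>2 \<le> (\<Sum>j<c. (cmod (A $$ (i,j)))\<^sup>2)"
    using assms by (intro member_le_sum) auto
  also have "\<dots> \<le> hs A"
    unfolding hs_alt[OF assms(1)] using assms
    by (intro member_le_sum[of i "{..<r}" "\<lambda>i. \<Sum>j<c. (cmod (A $$ (i,j)))\<^sup>2"]) (auto intro: sum_nonneg)
  finally show ?thesis .
qed

text \<open>Coprimality makes the root of unity primitive: equal powers give \<open>m * i\<close>
  congruent to \<open>m * j\<close> modulo \<open>n\<close>, and \<open>m\<close> cancels.\<close>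

lemma root_of_unity_power_inj:
  assumes "n > 0" "coprime m n" "i < n" "j < n"
    and "exp (2 * pi * \<i> * of_nat m / of_nat n) ^ i = exp (2 * pi * \<i> * of_nat m / of_nat n) ^ j"
  shows "i = j"
proof -
  have pow: "exp (2 * pi * \<i> * of_nat m / of_nat n) ^ k =
      exp (2 * complex_of_real pi * \<i> * of_nat (m * k) / of_nat n)" for k
    unfolding exp_of_nat_mult[symmetric] by (simp add: mult_ac)
  have "m * i mod n = m * j mod n"
    using assms complex_root_unity_eq[of n "m * i" "m * j"] unfolding pow by simp
  then have "[i = j] (mod n)"
    using assms(2) by (metis cong_def cong_mult_lcancel_nat)
  then show ?thesis using assms by (simp add: cong_def)
qed

text \<open>The difference is the entry of the commutator at \<open>(k, Suc k)\<close>. As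
  \<open>Suc k < n\<close>, the wrap-around entry of \<open>shift\<close> is avoided, and chaining
  over \<open>k\<close> still links all diagonal entries.\<close>

lemma hs_comm_shift_diag:
  assumes a: "a \<in> carrier_mat n n" and k: "Suc k < n"
  shows "(cmod (a $$ (Suc k, Suc k) - a $$ (k,k)))\<^sup>2 \<le> hs (comm (shift n) a)"
proof -
  have sh: "shift n \<in> carrier_mat n n" by (simp add: shift_def)
  have "(shift n * a) $$ (k, Suc k) = (\<Sum>l<n. if l = Suc k then a $$ (l, Suc k) else 0)"
    using a k sh mult_mat_index[OF sh a, of k "Suc k"]
    by (auto simp: shift_def simp del: index_mult_mat(1) sum.delta intro!: sum.cong)
  moreover have "(a * shift n) $$ (k, Suc k) = (\<Sum>l<n. if l = k then a $$ (k, l) else 0)"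
    using a k sh mult_mat_index[OF a sh, of k "Suc k"]
    by (auto simp: shift_def mod_Suc simp del: index_mult_mat(1) sum.delta intro!: sum.cong)
  ultimately have "comm (shift n) a $$ (k, Suc k) = a $$ (Suc k, Suc k) - a $$ (k,k)"
    using a k sh by (simp add: comm_def sum.delta del: index_mult_mat(1))
  then show ?thesis
    using hs_entry_le[of "comm (shift n) a" n n k "Suc k"] a k sh by simp
qed

text \<open>The left side is the sum of squared deviations from the mean, which minimizes the right
  side over \<open>c\<close>. A convenient \<open>c\<close>, later the entry at
  \<open>(0,0)\<close>, can thus replace the mean.\<close>

lemma sum_deviation_min:
  fixes g :: "nat \<Rightarrow> complex"
  assumes "n > 0"
  shows "(\<Sum>i<n. (cmod (g i))\<^sup>2) - (cmod (\<Sum>i<n. g i))\<^sup>2 / n \<le> (\<Sum>i<n. (cmod (g i - c))\<^sup>2)"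
proof -
  let ?G = "\<Sum>i<n. g i"
  have sq: "(cmod (z - w))\<^sup>2 = (cmod z)\<^sup>2 - 2 * Re (z * cnj w) + (cmod w)\<^sup>2" for z w
    unfolding cmod_power2 by (simp add: power2_eq_square algebra_simps)
  have "(\<Sum>i<n. (cmod (g i - c))\<^sup>2) = (\<Sum>i<n. (cmod (g i))\<^sup>2) - 2 * Re (?G * cnj c) + n * (cmod c)\<^sup>2"
    by (simp add: sq sum.distrib sum_subtractf sum_distrib_left sum_distrib_right)
  \<comment> \<open>Divided by \<open>n\<close>, this square is exactly the difference of the two
    sides.\<close>
  moreover have "(cmod (?G - n * c))\<^sup>2 = (cmod ?G)\<^sup>2 - n * (2 * Re (?G * cnj c)) + n * n * (cmod c)\<^sup>2"
    unfolding sq by (simp add: norm_mult power_mult_distrib algebra_simps power2_eq_square)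
  then have "(cmod ?G)\<^sup>2 / n - 2 * Re (?G * cnj c) + n * (cmod c)\<^sup>2 = (cmod (?G - n * c))\<^sup>2 / n"
    using assms by (simp add: field_simps)
  then have "(cmod ?G)\<^sup>2 / n - 2 * Re (?G * cnj c) + n * (cmod c)\<^sup>2 \<ge> 0" by simp
  ultimately show ?thesis by linarith
qed

lemma hs_split_diag:
  assumes "a \<in> carrier_mat n n"
  shows "hs a = (\<Sum>i<n. \<Sum>j<n. if i = j then 0 else (cmod (a $$ (i,j)))\<^sup>2) + (\<Sum>i<n. (cmod (a $$ (i,i)))\<^sup>2)"
proof -
  have "(\<Sum>j<n. (cmod (a $$ (i,j)))\<^sup>2) =
      (\<Sum>j<n. if i = j then 0 else (cmod (a $$ (i,j)))\<^sup>2) + (cmod (a $$ (i,i)))\<^sup>2" if "i < n" for i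
    using that by (simp add: sum.remove[of "{..<n}" i])
  then show ?thesis using assms by (simp add: hs_alt sum.distrib)
qed

text \<open>The bracket is the squared distance from \<open>a\<close> to the scalar matrices. The
  clock controls the off-diagonal entries, since the powers of \<open>q\<close> are distinct, and
  the shift controls the differences along the diagonal.\<close>

lemma clock_shift_spectral_gap:
  assumes n: "n > 0" and m: "coprime m n"
  shows "\<exists>\<kappa>>0. \<forall>a \<in> carrier_mat n n. \<kappa> * (hs a - (cmod (tr a))\<^sup>2 / n) \<le>
    hs (comm (clock n (exp (2 * pi * \<i> * of_nat m / of_nat n))) a) + hs (comm (shift n) a)"
proof -
  define q where "q = exp (2 * pi * \<i> * of_nat m / of_nat n)"
  define S where "S = (\<lambda>(i,j). (cmod (q ^ i - q ^ j))\<^sup>2) ` ({..<n} \<times> {..<n} - Id)"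
  \<comment> \<open>The extra element 1 keeps the set nonempty when \<open>n = 1\<close>.\<close>
  define \<mu> where "\<mu> = Min (insert 1 S)"
  have fin: "finite S" by (simp add: S_def)
  have "\<forall>s\<in>S. s > 0"
    using root_of_unity_power_inj[OF n m] by (auto simp: S_def q_def)
  then have \<mu>: "\<mu> > 0" using fin by (simp add: \<mu>_def)
  have \<mu>_le: "\<mu> \<le> (cmod (q ^ i - q ^ j))\<^sup>2" if "i < n" "j < n" "i \<noteq> j" for i j
    unfolding \<mu>_def using fin that by (intro Min_le) (auto simp: S_def)
  \<comment> \<open>The first summand pays for the off-diagonal entries. The second pays for
    \<open>n\<close> diagonal entries, each at distance at most \<open>n * sqrt E\<close> from the
    entry at \<open>(0,0)\<close>.\<close>
  define K where "K = 1 / \<mu> + real n ^ 3"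
  have K: "K > 0" using \<mu> n by (simp add: K_def add_pos_pos)
  have "hs a - (cmod (tr a))\<^sup>2 / n \<le> K * (hs (comm (clock n q) a) + hs (comm (shift n) a))"
    if a: "a \<in> carrier_mat n n" for a
  proof -
    define off where "off = (\<Sum>i<n. \<Sum>j<n. if i = j then 0 else (cmod (a $$ (i,j)))\<^sup>2)"
    define E where "E = hs (comm (shift n) a)"
    have E: "E \<ge> 0" by (simp add: E_def hs_nonneg)
    have "\<mu> * off \<le> (\<Sum>i<n. \<Sum>j<n. (cmod (q ^ i - q ^ j))\<^sup>2 * (cmod (a $$ (i,j)))\<^sup>2)"
      unfolding off_def sum_distrib_left using \<mu>_le
      by (intro sum_mono) (auto intro!: mult_right_mono)
    also have "\<dots> = hs (comm (clock n q) a)"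
      using a by (simp add: clock_def hs_alt[of _ n n] comm_diag_index norm_mult power_mult_distrib)
    finally have "off \<le> hs (comm (clock n q) a) / \<mu>"
      using \<mu> by (simp add: field_simps)
    \<comment> \<open>Telescoping along the diagonal: each step costs at most
      \<open>sqrt E\<close>.\<close>
    moreover have "cmod (a $$ (i,i) - a $$ (0,0)) \<le> real i * sqrt E" if "i < n" for i
      using that
    proof (induction i)
      case (Suc i)
      have "cmod (a $$ (Suc i, Suc i) - a $$ (i,i)) \<le> sqrt E"
        using hs_comm_shift_diag[OF a Suc.prems] by (simp add: E_def real_le_rsqrt)
      moreover have "cmod (a $$ (Suc i, Suc i) - a $$ (0,0)) \<le>
          cmod (a $$ (Suc i, Suc i) - a $$ (i,i)) + cmod (a $$ (i,i) - a $$ (0,0))"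
        using norm_triangle_ineq[of "a $$ (Suc i, Suc i) - a $$ (i,i)" "a $$ (i,i) - a $$ (0,0)"] by simp
      ultimately show ?case using Suc by (simp add: algebra_simps)
    qed simp
    then have "(cmod (a $$ (i,i) - a $$ (0,0)))\<^sup>2 \<le> real n ^ 2 * E" if "i < n" for i
    proof -
      have "cmod (a $$ (i,i) - a $$ (0,0)) \<le> real i * sqrt E" using that \<open>\<And>i. i < n \<Longrightarrow> cmod (a $$ (i,i) - a $$ (0,0)) \<le> real i * sqrt E\<close> by blast
      also have "\<dots> \<le> real n * sqrt E" using that E by (intro mult_right_mono) auto
      finally have "(cmod (a $$ (i,i) - a $$ (0,0)))\<^sup>2 \<le> (real n * sqrt E)\<^sup>2"
        by (intro power_mono) auto
      then show ?thesis using E by (simp add: power_mult_distrib)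
    qed
    then have "(\<Sum>i<n. (cmod (a $$ (i,i) - a $$ (0,0)))\<^sup>2) \<le> (\<Sum>i<n. real n ^ 2 * E)"
      by (intro sum_mono) auto
    then have "(\<Sum>i<n. (cmod (a $$ (i,i) - a $$ (0,0)))\<^sup>2) \<le> real n ^ 3 * E"
      by (simp add: power3_eq_cube power2_eq_square)
    moreover have "hs a - (cmod (tr a))\<^sup>2 / n \<le> off + (\<Sum>i<n. (cmod (a $$ (i,i) - a $$ (0,0)))\<^sup>2)"
      using sum_deviation_min[OF n, of "\<lambda>i. a $$ (i,i)" "a $$ (0,0)"] a
      by (simp add: hs_split_diag[OF a] off_def tr_def)
    ultimately have "hs a - (cmod (tr a))\<^sup>2 / n \<le> hs (comm (clock n q) a) / \<mu> + real n ^ 3 * E" by linarith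
    also have "\<dots> \<le> K * (hs (comm (clock n q) a) + E)"
      using \<mu> E hs_nonneg[of "comm (clock n q) a"] by (simp add: K_def algebra_simps)
    finally show ?thesis by (simp add: E_def)
  qed
  then have "\<forall>a \<in> carrier_mat n n. (1 / K) * (hs a - (cmod (tr a))\<^sup>2 / n) \<le>
      hs (comm (clock n q) a) + hs (comm (shift n) a)"
    using K by (simp add: field_simps)
  then show ?thesis using K unfolding q_def by (intro exI[of _ "1 / K"]) auto
qed

lemma spectral_gap:
  assumes n: "n > 0" and m: "coprime m n"
    and x: "x \<in> carrier_mat n n" "hermitian x" and y: "y \<in> carrier_mat n n" "hermitian y"
    and u: "clock n (exp (2 * pi * \<i> * of_nat m / of_nat n)) = mexp_i c x"
    and v: "shift n = mexp_i c y" and c: "c \<noteq> 0"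
  shows "\<exists>\<kappa>>0. \<forall>a \<in> carrier_mat n n.
    \<kappa> * (hs a - (cmod (tr a))\<^sup>2 / n) \<le> hs (comm x a) + hs (comm y a)"
proof -
  obtain \<kappa> where \<kappa>: "\<kappa> > 0" and gap: "\<And>a. a \<in> carrier_mat n n \<Longrightarrow>
      \<kappa> * (hs a - (cmod (tr a))\<^sup>2 / n) \<le> hs (comm (mexp_i c x) a) + hs (comm (mexp_i c y) a)"
    using clock_shift_spectral_gap[OF n m] unfolding u v by blast
  have "\<kappa> / c\<^sup>2 * (hs a - (cmod (tr a))\<^sup>2 / n) \<le> hs (comm x a) + hs (comm y a)"
    if a: "a \<in> carrier_mat n n" for a
  proof -
    have "\<kappa> * (hs a - (cmod (tr a))\<^sup>2 / n) \<le> c\<^sup>2 * (hs (comm x a) + hs (comm y a))"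
      using gap[OF a] hs_comm_mexp_i_le[OF x a, of c] hs_comm_mexp_i_le[OF y a, of c]
      by (simp add: algebra_simps)
    then show ?thesis using c by (simp add: field_simps)
  qed
  then show ?thesis using \<kappa> c by (intro exI[of _ "\<kappa> / c\<^sup>2"]) auto
qed

section \<open>Entropy and energy estimates\<close>

lemma tr_udiag:
  assumes "unitary U" "U \<in> carrier_mat n n"
  shows "tr (udiag n U f) = (\<Sum>i<n. f i)"
proof -
  have "tr (udiag n U f) = tr (mat_diag n f)"
    using tr_conj[OF assms, of "udiag n U f"] assms by (simp add: udiag_conj)
  then show ?thesis by (simp add: tr_def mat_diag_def)
qed

lemma hs_udiag:
  assumes "unitary U" "U \<in> carrier_mat n n"
  shows "hs (udiag n U f) = (\<Sum>i<n. (cmod (f i))\<^sup>2)"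
proof -
  have "hs (udiag n U f) = hs (mat_diag n f)"
    using hs_conj[OF assms, of "udiag n U f"] assms by (simp add: udiag_conj)
  also have "\<dots> = (\<Sum>i<n. \<Sum>j<n. if i = j then (cmod (f j))\<^sup>2 else 0)"
    by (auto simp: hs_def mat_diag_def simp del: sum.delta sum.delta' intro!: sum.cong)
  finally show ?thesis by simp
qed

lemma udiag_cong:
  assumes "\<And>i. i < n \<Longrightarrow> f i = g i"
  shows "udiag n U f = udiag n U g"
proof -
  have "mat_diag n f = mat_diag n g" using assms by (intro eq_matI) (auto simp: mat_diag_def)
  then show ?thesis by (simp add: udiag_def)
qed

lemma vn_entropy_udiag:
  assumes "unitary U" "U \<in> carrier_mat n n" "A = udiag n U (\<lambda>i. complex_of_real (d i))"
    "mlog A = udiag n U (\<lambda>i. complex_of_real (ln (d i)))"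
  shows "vn_entropy A = - (\<Sum>i<n. d i * ln (d i))"
  unfolding vn_entropy_def assms(4) unfolding assms(3)
  by (simp add: udiag_mult[OF assms(1,2)] tr_udiag[OF assms(1,2)])

text \<open>The spectrum of a density matrix is a probability vector. Its upper bound 1 is what
  gives \<open>ln\<close> slope at least 1 in the energy estimates.\<close>

lemma density_diagonalization:
  assumes "A \<in> carrier_mat n n" "strictly_positive A" "tr A = 1"
  obtains U d where "U \<in> carrier_mat n n" "unitary U"
    "A = udiag n U (\<lambda>i. complex_of_real (d i))" "mlog A = udiag n U (\<lambda>i. complex_of_real (ln (d i)))"
    "\<And>i. i < n \<Longrightarrow> d i > 0" "(\<Sum>i<n. d i) = 1" "\<And>i. i < n \<Longrightarrow> d i \<le> 1"
proof -
  obtain U d where U: "U \<in> carrier_mat n n" "unitary U"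
    and A: "A = udiag n U (\<lambda>i. complex_of_real (d i))"
    and L: "mlog A = udiag n U (\<lambda>i. complex_of_real (ln (d i)))"
    and d: "\<And>i. i < n \<Longrightarrow> d i > 0"
    using strictly_positive_diagonalization[OF assms(1,2)] by blast
  have "complex_of_real (\<Sum>i<n. d i) = 1" using assms(3) A tr_udiag[OF U(2,1)] by simp
  then have sum: "(\<Sum>i<n. d i) = 1" by (simp only: of_real_eq_1_iff)
  have "d i \<le> 1" if "i < n" for i
    using member_le_sum[of i "{..<n}" d] that d sum by (simp add: less_imp_le)
  then show ?thesis using that U A L d sum by blast
qed

text \<open>Identifies \<open>hs A - 1 / n\<close>, for trace 1, as the squared distance of the
  spectrum from the uniform one; nonnegativity and the equality case follow.\<close>

lemma hs_minus_inverse_dim: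
  fixes d :: "nat \<Rightarrow> real"
  assumes "n > 0" "(\<Sum>i<n. d i) = 1"
  shows "(\<Sum>i<n. (d i)\<^sup>2) - 1 / n = (\<Sum>i<n. (d i - 1 / n)\<^sup>2)"
proof -
  have "(\<Sum>i<n. (d i - 1 / n)\<^sup>2) = (\<Sum>i<n. (d i)\<^sup>2) - 2 / n * (\<Sum>i<n. d i) + n * (1 / n)\<^sup>2"
    by (simp add: power2_diff sum.distrib sum_subtractf sum_distrib_left sum_divide_distrib algebra_simps)
  then show ?thesis using assms by (simp add: power2_eq_square)
qed

lemma density_hs_ge:
  assumes "n > 0" "A \<in> carrier_mat n n" "strictly_positive A" "tr A = 1"
  shows "hs A - 1 / n \<ge> 0"
proof -
  obtain U d where U: "U \<in> carrier_mat n n" "unitary U" "A = udiag n U (\<lambda>i. complex_of_real (d i))"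
    and d: "(\<Sum>i<n. d i) = 1"
    using density_diagonalization[OF assms(2-4)] by metis
  have "hs A - 1 / n = (\<Sum>i<n. (d i - 1 / n)\<^sup>2)"
    using hs_minus_inverse_dim[OF assms(1) d] by (simp add: U(3) hs_udiag[OF U(2,1)])
  then show ?thesis by (simp add: sum_nonneg)
qed

lemma density_hs_eq_imp_maximally_mixed:
  assumes "n > 0" "A \<in> carrier_mat n n" "strictly_positive A" "tr A = 1" "hs A - 1 / n = 0"
  shows "A = (1 / of_nat n) \<cdot>\<^sub>m 1\<^sub>m n"
proof -
  obtain U d where U: "U \<in> carrier_mat n n" "unitary U" "A = udiag n U (\<lambda>i. complex_of_real (d i))"
    and d: "(\<Sum>i<n. d i) = 1"
    using density_diagonalization[OF assms(2-4)] by metis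
  have "(\<Sum>i<n. (d i - 1 / n)\<^sup>2) = 0"
    using hs_minus_inverse_dim[OF assms(1) d] assms(5) by (simp add: U(3) hs_udiag[OF U(2,1)])
  then have "d i = 1 / n" if "i < n" for i
    using that by (simp add: sum_nonneg_eq_0_iff)
  then have "A = udiag n U (\<lambda>i. 1 / of_nat n)"
    unfolding U(3) by (intro udiag_cong) simp
  then show ?thesis using udiag_const[OF U(2,1)] by simp
qed

text \<open>The deficit is the relative entropy with respect to the maximally mixed state, the sum
  of \<open>d i * ln (n * d i)\<close>. Both bounds come from
  \<open>1 - 1 / t \<le> ln t \<le> t - 1\<close> at \<open>t = n * d i\<close>.\<close>

lemma entropy_deficit_bounds:
  assumes "n > 0" "A \<in> carrier_mat n n" "strictly_positive A" "tr A = 1"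
  shows "vn_entropy A \<le> ln n" "ln n - vn_entropy A \<le> n * (hs A - 1 / n)"
proof -
  obtain U d where U: "U \<in> carrier_mat n n" "unitary U" and A: "A = udiag n U (\<lambda>i. complex_of_real (d i))"
    and L: "mlog A = udiag n U (\<lambda>i. complex_of_real (ln (d i)))"
    and d: "\<And>i. i < n \<Longrightarrow> d i > 0" "(\<Sum>i<n. d i) = 1"
    using density_diagonalization[OF assms(2-4)] by metis
  have "ln n - vn_entropy A = (\<Sum>i<n. d i) * ln n + (\<Sum>i<n. d i * ln (d i))"
    using vn_entropy_udiag[OF U(2,1) A L] d by simp
  also have "\<dots> = (\<Sum>i<n. d i * ln (n * d i))"
    using assms(1) d(1) unfolding sum_distrib_right sum.distrib[symmetric]
    by (intro sum.cong) (auto simp: ln_mult_pos algebra_simps)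
  finally have deficit: "ln n - vn_entropy A = (\<Sum>i<n. d i * ln (n * d i))" .
  have ln_ge: "1 - 1 / t \<le> ln t" if "t > 0" for t :: real
    using ln_le_minus_one[of "1 / t"] that by (simp add: ln_div)
  have "(\<Sum>i<n. d i * ln (n * d i)) \<ge> (\<Sum>i<n. d i - 1 / n)"
  proof (intro sum_mono)
    fix i assume "i \<in> {..<n}"
    then have p: "n * d i > 0" "d i > 0" using d assms by auto
    have "1 - 1 / (n * d i) \<le> ln (n * d i)"
      using ln_ge[OF p(1)] .
    then have "d i * (1 - 1 / (n * d i)) \<le> d i * ln (n * d i)"
      using p by (intro mult_left_mono) auto
    then show "d i - 1 / n \<le> d i * ln (n * d i)"
      using p assms(1) by (simp add: right_diff_distrib)
  qed
  then show "vn_entropy A \<le> ln n" using deficit d assms(1) by (simp add: sum_subtractf)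
  have "(\<Sum>i<n. d i * ln (n * d i)) \<le> (\<Sum>i<n. d i * (n * d i - 1))"
    using d assms(1) by (intro sum_mono mult_left_mono ln_le_minus_one) (auto simp: less_imp_le)
  also have "\<dots> = n * (\<Sum>i<n. (d i)\<^sup>2) - (\<Sum>i<n. d i)"
    by (simp add: algebra_simps sum_subtractf sum_distrib_left power2_eq_square)
  moreover have hsA: "hs A = (\<Sum>i<n. (d i)\<^sup>2)" unfolding A by (simp add: hs_udiag[OF U(2,1)])
  ultimately show "ln n - vn_entropy A \<le> n * (hs A - 1 / n)"
    unfolding deficit hsA using d assms(1) by (simp add: algebra_simps)
qed

text \<open>This is the first-order Taylor remainder of \<open>t * ln t\<close> at \<open>a\<close>,
  equal to \<open>b * ln (b / a) - (b - a)\<close>. Both bounds follow from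
  \<open>ln t \<le> t - 1\<close>, at \<open>a / b\<close> and at \<open>b / a\<close>, so the
  quadratic one holds even for \<open>b\<close> far from \<open>a\<close>.\<close>

lemma xlogx_taylor:
  fixes a b :: real
  assumes "a > 0" "b > 0"
  shows "b * ln b - a * ln a - (b - a) * ln a - (b - a) \<ge> 0"
    and "b * ln b - a * ln a - (b - a) * ln a - (b - a) \<le> (b - a)\<^sup>2 / a"
proof -
  have eq: "b * ln b - a * ln a - (b - a) * ln a = b * ln (b / a)"
    using assms by (simp add: ln_div algebra_simps)
  have "ln (a / b) \<le> a / b - 1" using assms by (intro ln_le_minus_one) simp
  then have "b * ln (a / b) \<le> b * (a / b - 1)" using assms by (intro mult_left_mono) auto
  then show "b * ln b - a * ln a - (b - a) * ln a - (b - a) \<ge> 0"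
    unfolding eq using assms by (simp add: ln_div algebra_simps)
  have "ln (b / a) \<le> b / a - 1" using assms by (intro ln_le_minus_one) simp
  then have "b * ln (b / a) \<le> b * (b / a - 1)" using assms by (intro mult_left_mono) auto
  then show "b * ln b - a * ln a - (b - a) * ln a - (b - a) \<le> (b - a)\<^sup>2 / a"
    unfolding eq using assms by (simp add: field_simps power2_eq_square)
qed

text \<open>The expression inside the modulus is the relative entropy of \<open>B\<close> with
  respect to \<open>A\<close>. Written in the two eigenbases it is an
  \<open>overlap\<close>-weighted sum of scalar remainders, to which \<open>xlogx_taylor\<close>
  applies. \<open>C\<close> depends on \<open>A\<close> alone, so \<open>B\<close> may later run
  along the flow.\<close>

lemma entropy_taylor:
  assumes A: "A \<in> carrier_mat n n" "strictly_positive A" "tr A = 1"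
  shows "\<exists>C. \<forall>B. B \<in> carrier_mat n n \<and> strictly_positive B \<and> tr B = 1 \<longrightarrow>
    \<bar>vn_entropy A - vn_entropy B - Re (tr ((B - A) * mlog A))\<bar> \<le> C * hs (B - A)"
proof -
  obtain U a where U: "U \<in> carrier_mat n n" "unitary U" and AU: "A = udiag n U (\<lambda>i. complex_of_real (a i))"
    and LA: "mlog A = udiag n U (\<lambda>i. complex_of_real (ln (a i)))"
    and a: "\<And>i. i < n \<Longrightarrow> a i > 0" "(\<Sum>i<n. a i) = 1"
    using density_diagonalization[OF A] by metis
  \<comment> \<open>A single constant above every \<open>1 / a i\<close>.\<close>
  define C where "C = (\<Sum>i<n. 1 / a i)"
  have C: "1 / a i \<le> C" if "i < n" for i
    unfolding C_def using that a by (intro member_le_sum[of i "{..<n}" "\<lambda>i. 1 / a i"]) (auto simp: less_imp_le)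
  have "\<bar>vn_entropy A - vn_entropy B - Re (tr ((B - A) * mlog A))\<bar> \<le> C * hs (B - A)"
    if B: "B \<in> carrier_mat n n" "strictly_positive B" "tr B = 1" for B
  proof -
    obtain V b where V: "V \<in> carrier_mat n n" "unitary V" and BV: "B = udiag n V (\<lambda>i. complex_of_real (b i))"
      and LB: "mlog B = udiag n V (\<lambda>i. complex_of_real (ln (b i)))"
      and b: "\<And>i. i < n \<Longrightarrow> b i > 0" "(\<Sum>i<n. b i) = 1"
      using density_diagonalization[OF B] by metis
    let ?w = "overlap U V"
    \<comment> \<open>Row and column sums equal to 1 spread a sum over one spectrum into a double
      sum, so that all terms carry the same weights.\<close>
    have sumA: "(\<Sum>i<n. g i) = (\<Sum>i<n. \<Sum>j<n. ?w i j * g i)" for g :: "nat \<Rightarrow> real"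
      using overlap_row_sum[OF U(2,1) V(2,1)] by (simp add: sum_distrib_right[symmetric])
    have sumB: "(\<Sum>j<n. g j) = (\<Sum>i<n. \<Sum>j<n. ?w i j * g j)" for g :: "nat \<Rightarrow> real"
      using overlap_col_sum[OF U(2,1) V(2,1)]
      by (subst sum.swap) (simp add: sum_distrib_right[symmetric])
    have LAc: "mlog A \<in> carrier_mat n n" unfolding LA using U by simp
    have "tr (B * mlog A) = tr (mlog A * B)" using B LAc by (simp add: tr_mult_comm[of _ n n])
    also have "\<dots> = (\<Sum>i<n. \<Sum>j<n. ?w i j * (ln (a i) * b j))"
      unfolding LA BV by (rule tr_udiag_udiag[OF U(2,1) V(2,1)])
    finally have trBLA: "Re (tr (B * mlog A)) = (\<Sum>i<n. \<Sum>j<n. ?w i j * (ln (a i) * b j))" by simp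
    have trALA: "Re (tr (A * mlog A)) = (\<Sum>i<n. \<Sum>j<n. ?w i j * (a i * ln (a i)))"
      unfolding LA unfolding AU using sumA[of "\<lambda>i. a i * ln (a i)"]
      by (simp add: udiag_mult[OF U(2,1)] tr_udiag[OF U(2,1)])
    have dtr: "Re (tr ((B - A) * mlog A)) = Re (tr (B * mlog A)) - Re (tr (A * mlog A))"
      using A B LAc by (simp add: minus_mult_distrib_mat[of _ n n _ _ n] tr_diff[of _ n] mult_carrier_mat[of _ n n _ n])
    \<comment> \<open>The two added traces cancel, both being 1; they supply the term
      \<open>b j - a i\<close> of the scalar remainder.\<close>
    have "vn_entropy A - vn_entropy B - Re (tr ((B - A) * mlog A)) - (\<Sum>i<n. b i) + (\<Sum>i<n. a i) =
        (\<Sum>i<n. \<Sum>j<n. ?w i j * (b j * ln (b j) - a i * ln (a i) - (b j - a i) * ln (a i) - (b j - a i)))"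
      unfolding vn_entropy_udiag[OF U(2,1) AU LA] vn_entropy_udiag[OF V(2,1) BV LB] dtr trBLA trALA
      unfolding sumA[of a] sumB[of b] sumA[of "\<lambda>i. a i * ln (a i)"] sumB[of "\<lambda>i. b i * ln (b i)"]
      by (simp add: algebra_simps sum.distrib sum_subtractf)
    then have key: "vn_entropy A - vn_entropy B - Re (tr ((B - A) * mlog A)) =
        (\<Sum>i<n. \<Sum>j<n. ?w i j * (b j * ln (b j) - a i * ln (a i) - (b j - a i) * ln (a i) - (b j - a i)))"
      by (simp add: a b)
    have hA: "adj A = A" "adj B = B" using A B by (auto simp: strictly_positive_def positive_mat_def hermitian_def)
    have "adj (B - A) = B - A"
    proof (rule eq_matI)
      fix i j assume "i < dim_row (B - A)" "j < dim_col (B - A)"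
      then have "i < n" "j < n" using A by auto
      then show "adj (B - A) $$ (i,j) = (B - A) $$ (i,j)"
        using A B arg_cong[OF hA(1), of "\<lambda>M. M $$ (i,j)"] arg_cong[OF hA(2), of "\<lambda>M. M $$ (i,j)"] by simp
    qed (use A B in auto)
    \<comment> \<open>Expanding the square expresses the distance with the same weights, so that the
      error can be compared pair by pair.\<close>
    then have "complex_of_real (hs (B - A)) = tr ((B - A) * (B - A))" by (simp add: hs_tr)
    also have "\<dots> = tr (B * B) + tr (A * A) - 2 * tr (A * B)"
      using A B tr_mult_comm[of B n n A]
      by (simp add: minus_mult_distrib_mat[of _ n n _ _ n] mult_minus_distrib_mat[of _ n n _ n]
          minus_carrier_mat tr_diff[of _ n] mult_carrier_mat[of _ n n _ n])
    also have "tr (A * B) = (\<Sum>i<n. \<Sum>j<n. ?w i j * (a i * b j))"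
      unfolding AU BV by (rule tr_udiag_udiag[OF U(2,1) V(2,1)])
    also have "tr (A * A) = complex_of_real (\<Sum>i<n. a i * a i)"
      unfolding AU by (simp add: udiag_mult[OF U(2,1)] tr_udiag[OF U(2,1)])
    also have "tr (B * B) = complex_of_real (\<Sum>i<n. b i * b i)"
      unfolding BV by (simp add: udiag_mult[OF V(2,1)] tr_udiag[OF V(2,1)])
    finally have "complex_of_real (hs (B - A)) = complex_of_real ((\<Sum>i<n. b i * b i) + (\<Sum>i<n. a i * a i)
        - 2 * (\<Sum>i<n. \<Sum>j<n. ?w i j * (a i * b j)))"
      by (simp only: of_real_add of_real_diff of_real_mult of_real_numeral)
    then have "hs (B - A) = (\<Sum>i<n. b i * b i) + (\<Sum>i<n. a i * a i)
        - 2 * (\<Sum>i<n. \<Sum>j<n. ?w i j * (a i * b j))"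
      by (simp only: of_real_eq_iff)
    also have "\<dots> = (\<Sum>i<n. \<Sum>j<n. ?w i j * (b j - a i)\<^sup>2)"
      unfolding sumA[of "\<lambda>i. a i * a i"] sumB[of "\<lambda>i. b i * b i"] sum_distrib_left
      by (simp add: power2_eq_square algebra_simps sum.distrib sum_subtractf)
    finally have hsBA: "hs (B - A) = (\<Sum>i<n. \<Sum>j<n. ?w i j * (b j - a i)\<^sup>2)" .
    have "vn_entropy A - vn_entropy B - Re (tr ((B - A) * mlog A)) \<ge> 0"
      unfolding key using a b by (intro sum_nonneg mult_nonneg_nonneg overlap_nonneg xlogx_taylor) auto
    moreover have "vn_entropy A - vn_entropy B - Re (tr ((B - A) * mlog A)) \<le>
        (\<Sum>i<n. \<Sum>j<n. ?w i j * (C * (b j - a i)\<^sup>2))"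
      unfolding key
    proof (intro sum_mono mult_left_mono overlap_nonneg)
      fix i j assume "i \<in> {..<n}" "j \<in> {..<n}"
      then have "b j * ln (b j) - a i * ln (a i) - (b j - a i) * ln (a i) - (b j - a i) \<le> 1 / a i * (b j - a i)\<^sup>2"
        using xlogx_taylor(2)[of "a i" "b j"] a b by simp
      also have "\<dots> \<le> C * (b j - a i)\<^sup>2"
        using C \<open>i \<in> {..<n}\<close> by (intro mult_right_mono) auto
      finally show "b j * ln (b j) - a i * ln (a i) - (b j - a i) * ln (a i) - (b j - a i) \<le> C * (b j - a i)\<^sup>2" .
    qed
    moreover have "(\<Sum>i<n. \<Sum>j<n. ?w i j * (C * (b j - a i)\<^sup>2)) = C * hs (B - A)"
      unfolding hsBA sum_distrib_left by (intro sum.cong) auto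
    ultimately show ?thesis by linarith
  qed
  then show ?thesis by blast
qed

text \<open>The slope of \<open>ln\<close> is at least 1 on \<open>(0,1]\<close> and at most
  \<open>1 / \<epsilon>\<close> from \<open>\<epsilon>\<close> on. Every term is symmetric in
  \<open>a\<close> and \<open>b\<close>, so \<open>b \<le> a\<close> may be assumed.\<close>

lemma ln_diff_bounds:
  fixes a b :: real
  assumes "0 < a" "a \<le> 1" "0 < b" "b \<le> 1"
  shows "(a - b)\<^sup>2 \<le> (ln a - ln b) * (ln a - ln b)" "(a - b)\<^sup>2 \<le> (a - b) * (ln a - ln b)"
    "\<epsilon> > 0 \<Longrightarrow> a \<ge> \<epsilon> \<Longrightarrow> b \<ge> \<epsilon> \<Longrightarrow> (a - b) * (ln a - ln b) \<le> (a - b)\<^sup>2 / \<epsilon>"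
proof -
  have main: "a - b \<le> ln a - ln b \<and> (\<forall>\<epsilon>>0. b \<ge> \<epsilon> \<longrightarrow> ln a - ln b \<le> (a - b) / \<epsilon>)"
    if "0 < b" "b \<le> a" "a \<le> 1" for a b :: real
  proof -
    have "ln (b / a) \<le> b / a - 1" "ln (a / b) \<le> a / b - 1" using that by (auto intro!: ln_le_minus_one)
    then have 1: "(a - b) / a \<le> ln a - ln b" "ln a - ln b \<le> (a - b) / b"
      using that by (auto simp: ln_div field_simps)
    have "(a - b) * a \<le> (a - b) * 1" using that by (intro mult_left_mono) auto
    then have "a - b \<le> (a - b) / a" using that by (simp add: field_simps)
    moreover have "(a - b) / b \<le> (a - b) / \<epsilon>" if "\<epsilon> > 0" "b \<ge> \<epsilon>" for \<epsilon>
      using that \<open>b \<le> a\<close> by (intro divide_left_mono) auto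
    ultimately show ?thesis using 1 by fastforce
  qed
  have *: "(a - b)\<^sup>2 \<le> (ln a - ln b) * (ln a - ln b) \<and> (a - b)\<^sup>2 \<le> (a - b) * (ln a - ln b) \<and>
      (\<forall>\<epsilon>>0. b \<ge> \<epsilon> \<longrightarrow> (a - b) * (ln a - ln b) \<le> (a - b)\<^sup>2 / \<epsilon>)"
    if "0 < b" "b \<le> a" "a \<le> 1" for a b :: real
  proof -
    note m = main[OF that]
    have "(a - b) * (a - b) \<le> (ln a - ln b) * (ln a - ln b)" "(a - b) * (a - b) \<le> (a - b) * (ln a - ln b)"
      using m that by (auto intro!: mult_mono mult_left_mono)
    moreover have "(a - b) * (ln a - ln b) \<le> (a - b) * ((a - b) / \<epsilon>)" if "\<epsilon> > 0" "b \<ge> \<epsilon>" for \<epsilon>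
      using m that \<open>b \<le> a\<close> by (intro mult_left_mono) auto
    ultimately show ?thesis by (simp add: power2_eq_square)
  qed
  have swap: "(b - a) * (ln b - ln a) = (a - b) * (ln a - ln b)"
    "(ln b - ln a) * (ln b - ln a) = (ln a - ln b) * (ln a - ln b)" "(b - a)\<^sup>2 = (a - b)\<^sup>2"
    by (simp_all add: algebra_simps power2_eq_square)
  consider "b \<le> a" | "a \<le> b" by linarith
  then have "(a - b)\<^sup>2 \<le> (ln a - ln b) * (ln a - ln b) \<and> (a - b)\<^sup>2 \<le> (a - b) * (ln a - ln b) \<and>
      (\<forall>\<epsilon>>0. a \<ge> \<epsilon> \<and> b \<ge> \<epsilon> \<longrightarrow> (a - b) * (ln a - ln b) \<le> (a - b)\<^sup>2 / \<epsilon>)"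
  proof cases
    case 1 then show ?thesis using *[of b a] assms by blast
  next
    case 2 then show ?thesis using *[of a b] assms unfolding swap by blast
  qed
  then show "(a - b)\<^sup>2 \<le> (ln a - ln b) * (ln a - ln b)" "(a - b)\<^sup>2 \<le> (a - b) * (ln a - ln b)"
    "\<epsilon> > 0 \<Longrightarrow> a \<ge> \<epsilon> \<Longrightarrow> b \<ge> \<epsilon> \<Longrightarrow> (a - b) * (ln a - ln b) \<le> (a - b)\<^sup>2 / \<epsilon>"
    by blast+
qed

text \<open>All traces are sums with the same weights \<open>Z i j\<close>, so
  \<open>ln_diff_bounds\<close> applies termwise. The first bound feeds entropy growth and the
  second the decay of \<open>f\<close>; the third is the reverse estimate near the maximally mixed
  state.\<close>

lemma energy_bounds:
  assumes A: "A \<in> carrier_mat n n" "strictly_positive A" "tr A = 1"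
    and z: "z \<in> carrier_mat n n" "hermitian z"
  shows "hs (comm z A) \<le> Re (tr (mlog A * comm z (comm z (mlog A))))"
    and "hs (comm z A) \<le> Re (tr (A * comm z (comm z (mlog A))))"
    and "n > 0 \<Longrightarrow> hs A - 1 / n \<le> 1 / (4 * (real n)\<^sup>2) \<Longrightarrow>
      Re (tr (A * comm z (comm z (mlog A)))) \<le> 8 * (real n)\<^sup>2 * hs z * (hs A - 1 / n)"
proof -
  obtain U d where U: "U \<in> carrier_mat n n" "unitary U" and AU: "A = udiag n U (\<lambda>i. complex_of_real (d i))"
    and L: "mlog A = udiag n U (\<lambda>i. complex_of_real (ln (d i)))"
    and d: "\<And>i. i < n \<Longrightarrow> d i > 0" "(\<Sum>i<n. d i) = 1" "\<And>i. i < n \<Longrightarrow> d i \<le> 1"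
    using density_diagonalization[OF A] by metis
  define Z where "Z i j = (cmod ((adj U * z * U) $$ (i,j)))\<^sup>2" for i j
  have Z: "Z i j \<ge> 0" for i j by (simp add: Z_def)
  have "hs (comm z A) = (\<Sum>i<n. \<Sum>j<n. (d i - d j)\<^sup>2 * Z i j)"
    using hs_comm_udiag[OF U(2,1) z(1), of "\<lambda>i. complex_of_real (d i)"] hs_comm_commute[OF z(1) A(1)]
    by (simp add: Z_def norm_of_real AU flip: of_real_diff)
  then have hc: "hs (comm z A) = (\<Sum>i<n. \<Sum>j<n. Z i j * (d i - d j)\<^sup>2)" by (simp add: mult.commute)
  have E1: "Re (tr (mlog A * comm z (comm z (mlog A)))) =
      (\<Sum>i<n. \<Sum>j<n. Z i j * ((ln (d i) - ln (d j)) * (ln (d i) - ln (d j))))"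
    unfolding L tr_udiag_comm_comm[OF U(2,1) z(2,1)] Z_def by simp
  have E2: "Re (tr (A * comm z (comm z (mlog A)))) =
      (\<Sum>i<n. \<Sum>j<n. Z i j * ((d i - d j) * (ln (d i) - ln (d j))))"
    unfolding L unfolding AU tr_udiag_comm_comm[OF U(2,1) z(2,1)] Z_def by simp
  show "hs (comm z A) \<le> Re (tr (mlog A * comm z (comm z (mlog A))))"
    unfolding hc E1 using d by (intro sum_mono mult_left_mono Z ln_diff_bounds) auto
  show "hs (comm z A) \<le> Re (tr (A * comm z (comm z (mlog A))))"
    unfolding hc E2 using d by (intro sum_mono mult_left_mono Z ln_diff_bounds) auto
  assume n: "n > 0" and small: "hs A - 1 / n \<le> 1 / (4 * (real n)\<^sup>2)"
  define f where "f = hs A - 1 / n"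
  have f: "f = (\<Sum>i<n. (d i - 1 / n)\<^sup>2)"
    unfolding f_def AU hs_udiag[OF U(2,1)] using hs_minus_inverse_dim[OF n d(2)] by simp
  have fi: "(d i - 1 / n)\<^sup>2 \<le> f" if "i < n" for i
    unfolding f using that by (intro member_le_sum[of i "{..<n}" "\<lambda>i. (d i - 1 / n)\<^sup>2"]) auto
  \<comment> \<open>The threshold in \<open>small\<close> is the square of
    \<open>1 / (2 * n)\<close>, so each eigenvalue stays within that distance of
    \<open>1 / n\<close>.\<close>
  have dge: "d i \<ge> 1 / (2 * n)" if "i < n" for i
  proof -
    have "(d i - 1 / n)\<^sup>2 \<le> (1 / (2 * n))\<^sup>2"
      using fi[OF that] small by (simp add: f_def power_divide power_mult_distrib)
    then have "\<bar>d i - 1 / n\<bar> \<le> 1 / (2 * n)" by (simp add: abs_le_square_iff[symmetric])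
    moreover have "1 / real n = 1 / (2 * n) + 1 / (2 * n)" using n by (simp add: field_simps)
    ultimately show ?thesis by linarith
  qed
  have hz: "hs z = (\<Sum>i<n. \<Sum>j<n. Z i j)"
  proof -
    have "adj U * z * U \<in> carrier_mat n n" using U z by (simp add: mult_carrier_mat[of _ n n _ n])
    then show ?thesis using hs_conj[OF U(2,1) z(1)] by (simp add: hs_alt[of _ n n] Z_def)
  qed
  have sq: "(p - r)\<^sup>2 \<le> 2 * (p - c)\<^sup>2 + 2 * (r - c)\<^sup>2" for p r c :: real
    using zero_le_power2[of "(p - c) + (r - c)"] by (simp add: power2_eq_square algebra_simps)
  \<comment> \<open>The factor \<open>8 * n\<close> is the slope bound \<open>2 * n\<close> times 4,
    the latter from splitting \<open>d i - d j\<close> at \<open>1 / n\<close>.\<close>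
  have "Re (tr (A * comm z (comm z (mlog A)))) \<le> (\<Sum>i<n. \<Sum>j<n. Z i j * (8 * n * f))"
    unfolding E2
  proof (intro sum_mono mult_left_mono Z)
    fix i j assume "i \<in> {..<n}" "j \<in> {..<n}"
    then have ij: "i < n" "j < n" by auto
    have "(d i - d j) * (ln (d i) - ln (d j)) \<le> (d i - d j)\<^sup>2 / (1 / (2 * n))"
      using ij d dge n by (intro ln_diff_bounds(3)) auto
    also have "\<dots> = 2 * n * (d i - d j)\<^sup>2" by simp
    also have "(d i - d j)\<^sup>2 \<le> 2 * (d i - 1 / n)\<^sup>2 + 2 * (d j - 1 / n)\<^sup>2"
      by (rule sq)
    also have "\<dots> \<le> 4 * f" using fi[OF ij(1)] fi[OF ij(2)] by linarith
    finally show "(d i - d j) * (ln (d i) - ln (d j)) \<le> 8 * n * f" using n by simp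
  qed
  also have "\<dots> = 8 * n * hs z * f" by (simp add: hz sum_distrib_left sum_distrib_right mult_ac)
  also have "\<dots> \<le> 8 * (real n)\<^sup>2 * hs z * f"
  proof -
    have "f \<ge> 0" unfolding f by (simp add: sum_nonneg)
    moreover have "real n \<le> (real n)\<^sup>2" using n by (simp add: power2_eq_square)
    ultimately show ?thesis using hs_nonneg[of z] by (intro mult_right_mono) auto
  qed
  finally show "Re (tr (A * comm z (comm z (mlog A)))) \<le> 8 * (real n)\<^sup>2 * hs z * (hs A - 1 / n)"
    by (simp add: f_def)
qed

section \<open>The flow\<close>

lemma comm_uminus_right:
  assumes "A \<in> carrier_mat n n" "B \<in> carrier_mat n n"
  shows "comm A (- B) = - comm A B"
  using assms unfolding comm_def
  by (intro eq_matI) (auto simp: mult_mat_index[of _ n n _ n] sum_negf simp del: index_mult_mat(1))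

text \<open>The two signs of the second derivation cancel, so \<open>x\<close> and \<open>y\<close>
  enter alike.\<close>

lemma laplacian_eq:
  assumes "x \<in> carrier_mat n n" "y \<in> carrier_mat n n" "a \<in> carrier_mat n n"
  shows "laplacian x y a = comm y (comm y a) + comm x (comm x a)"
  using assms by (simp add: laplacian_def comm_uminus_right[of _ n])

lemma laplacian_carrier [simp]:
  assumes "x \<in> carrier_mat n n" "y \<in> carrier_mat n n" "a \<in> carrier_mat n n"
  shows "laplacian x y a \<in> carrier_mat n n"
  using assms by (simp add: laplacian_eq[of _ n])

lemma tr_mult_laplacian:
  assumes "x \<in> carrier_mat n n" "y \<in> carrier_mat n n" "a \<in> carrier_mat n n" "b \<in> carrier_mat n n"
  shows "tr (b * laplacian x y a) = tr (b * comm x (comm x a)) + tr (b * comm y (comm y a))"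
  using assms
  by (simp add: laplacian_eq[of _ n] mult_add_distrib_mat[of _ n n _ n] tr_add[of _ n] mult_carrier_mat[of _ n n _ n])

lemma tr_uminus: "tr (- A) = - tr A" if "A \<in> carrier_mat n n"
  using that by (auto simp: tr_def sum_negf)

lemma tr_uminus_mult:
  assumes "A \<in> carrier_mat n n" "B \<in> carrier_mat n n"
  shows "tr (- A * B) = - tr (A * B)" "tr (B * - A) = - tr (B * A)"
  using assms by (simp_all add: tr_uminus[of _ n] mult_carrier_mat[of _ n n _ n])

lemma has_vector_derivative_tr_mult:
  assumes M: "\<And>s. s \<in> S \<Longrightarrow> M s \<in> carrier_mat n n" and t: "t \<in> S"
    and D: "D \<in> carrier_mat n n" and B: "B \<in> carrier_mat n n"
    and der: "\<And>i j. i < n \<Longrightarrow> j < n \<Longrightarrow>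
      ((\<lambda>s. M s $$ (i,j)) has_vector_derivative D $$ (i,j)) (at t within S)"
  shows "((\<lambda>s. tr (M s * B)) has_vector_derivative tr (D * B)) (at t within S)"
proof -
  have "((\<lambda>s. \<Sum>i<n. \<Sum>l<n. M s $$ (i,l) * B $$ (l,i)) has_vector_derivative
      (\<Sum>i<n. \<Sum>l<n. D $$ (i,l) * B $$ (l,i))) (at t within S)"
    by (intro has_vector_derivative_sum has_vector_derivative_mult_left der) auto
  then show ?thesis
    unfolding tr_mult_index[OF D B]
    by (rule has_vector_derivative_transform[OF t, rotated]) (use M B in \<open>auto simp: tr_mult_index[of _ n n]\<close>)
qed

lemma has_real_derivative_hs:
  assumes M: "\<And>s. s \<in> S \<Longrightarrow> M s \<in> carrier_mat n n" and t: "t \<in> S"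
    and D: "D \<in> carrier_mat n n"
    and der: "\<And>i j. i < n \<Longrightarrow> j < n \<Longrightarrow>
      ((\<lambda>s. M s $$ (i,j)) has_vector_derivative D $$ (i,j)) (at t within S)"
  shows "((\<lambda>s. hs (M s)) has_real_derivative 2 * Re (tr (adj (M t) * D))) (at t within S)"
proof -
  have "((\<lambda>s. \<Sum>i<n. \<Sum>j<n. inner (M s $$ (i,j)) (M s $$ (i,j))) has_vector_derivative
      (\<Sum>i<n. \<Sum>j<n. inner (M t $$ (i,j)) (D $$ (i,j)) + inner (D $$ (i,j)) (M t $$ (i,j)))) (at t within S)"
    by (intro has_vector_derivative_sum bounded_bilinear.has_vector_derivative[OF bounded_bilinear_inner] der) auto
  moreover have "(\<Sum>i<n. \<Sum>j<n. inner (M t $$ (i,j)) (D $$ (i,j)) + inner (D $$ (i,j)) (M t $$ (i,j))) = 2 * Re (tr (adj (M t) * D))"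
  proof -
    have "tr (adj (M t) * D) = (\<Sum>j<n. \<Sum>i<n. cnj (M t $$ (i,j)) * D $$ (i,j))"
      using M[OF t] D by (subst tr_mult_index[of _ n n]) auto
    then have "2 * Re (tr (adj (M t) * D)) = (\<Sum>i<n. \<Sum>j<n. 2 * Re (cnj (M t $$ (i,j)) * D $$ (i,j)))"
      by (subst (asm) sum.swap) (simp add: sum_distrib_left)
    then show ?thesis by (simp add: inner_complex_def algebra_simps)
  qed
  ultimately have "((\<lambda>s. \<Sum>i<n. \<Sum>j<n. inner (M s $$ (i,j)) (M s $$ (i,j))) has_vector_derivative
      2 * Re (tr (adj (M t) * D))) (at t within S)" by simp
  then have "((\<lambda>s. hs (M s)) has_vector_derivative 2 * Re (tr (adj (M t) * D))) (at t within S)"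
    by (rule has_vector_derivative_transform[OF t, rotated])
      (use M in \<open>auto simp: hs_alt[of _ n n] power2_norm_eq_inner\<close>)
  then show ?thesis by (simp add: has_real_derivative_iff_has_vector_derivative)
qed

text \<open>The difference quotient of \<open>R\<close> is squeezed by that of \<open>h\<close>, so
  differentiability of \<open>R\<close> is a conclusion. It is meant for the entropy minus its
  linear part.\<close>

lemma has_derivative_of_small_remainder:
  fixes R h :: "real \<Rightarrow> real"
  assumes t: "t \<in> S" and le: "\<And>s. s \<in> S \<Longrightarrow> \<bar>R s - R t\<bar> \<le> C * h s" and h0: "h t = 0"
    and h: "(h has_real_derivative 0) (at t within S)"
  shows "(R has_real_derivative 0) (at t within S)"
proof -
  have "((\<lambda>s. C * ((h s - h t) / (s - t))) \<longlongrightarrow> C * 0) (at t within S)"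
    using h unfolding has_field_derivative_iff by (intro tendsto_mult tendsto_const)
  then have "((\<lambda>s. \<bar>C * ((h s - h t) / (s - t))\<bar>) \<longlongrightarrow> 0) (at t within S)"
    using tendsto_rabs_zero by fastforce
  moreover have "eventually (\<lambda>s. norm ((R s - R t) / (s - t)) \<le> \<bar>C * ((h s - h t) / (s - t))\<bar>) (at t within S)"
    unfolding eventually_at_filter
  proof (intro always_eventually allI impI)
    fix s assume "s \<noteq> t" "s \<in> S"
    have "\<bar>R s - R t\<bar> \<le> \<bar>C * h s\<bar>" using le[OF \<open>s \<in> S\<close>] by linarith
    then have "\<bar>R s - R t\<bar> / \<bar>s - t\<bar> \<le> \<bar>C * h s\<bar> / \<bar>s - t\<bar>" by (intro divide_right_mono) auto
    then show "norm ((R s - R t) / (s - t)) \<le> \<bar>C * ((h s - h t) / (s - t))\<bar>"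
      by (simp add: h0 abs_mult)
  qed
  ultimately show ?thesis
    unfolding has_field_derivative_iff by (rule Lim_null_comparison[rotated])
qed

section \<open>Monotonicity and Gronwall arguments on a half-line\<close>

context
  fixes t0 :: real and g g' :: "real \<Rightarrow> real"
  assumes g: "\<And>t. t \<ge> t0 \<Longrightarrow> (g has_real_derivative g' t) (at t within {t0..})"
begin

lemma continuous_on_half_line: "t0 \<le> a \<Longrightarrow> continuous_on {a..b} g"
  by (rule DERIV_continuous_on, rule DERIV_subset[OF g]) auto

lemma derivative_interior: "t0 < t \<Longrightarrow> DERIV g t :> g' t"
  using g[of t] by (simp add: at_within_interior[of t "{t0..}"])

lemma nonincreasing_half_line:
  assumes "t0 \<le> a" "a \<le> b" "\<And>t. a < t \<Longrightarrow> t < b \<Longrightarrow> g' t \<le> 0"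
  shows "g b \<le> g a"
  using assms derivative_interior
  by (intro DERIV_nonpos_imp_decreasing_open[OF _ _ continuous_on_half_line]) force+

lemma nondecreasing_half_line:
  assumes "t0 \<le> a" "a \<le> b" "\<And>t. a < t \<Longrightarrow> t < b \<Longrightarrow> g' t \<ge> 0"
  shows "g a \<le> g b"
  using assms derivative_interior
  by (intro DERIV_nonneg_imp_increasing_open[OF _ _ continuous_on_half_line]) force+

lemma increasing_half_line:
  assumes "t0 \<le> a" "a < b" "\<And>t. a < t \<Longrightarrow> t < b \<Longrightarrow> g' t > 0"
  shows "g a < g b"
  using assms derivative_interior
  by (intro DERIV_pos_imp_increasing_open[OF _ _ continuous_on_half_line]) force+

text \<open>The integrating factor behind both the decay estimate and backward uniqueness.\<close>

lemma has_derivative_exp_mult: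
  assumes "t \<ge> t0"
  shows "((\<lambda>s. g s * exp (k * s)) has_real_derivative (g' t + k * g t) * exp (k * t)) (at t within {t0..})"
  by (rule derivative_eq_intros g assms refl | simp add: algebra_simps)+

end

lemma exponential_decay:
  fixes g g' :: "real \<Rightarrow> real"
  assumes g: "\<And>t. t \<ge> t0 \<Longrightarrow> (g has_real_derivative g' t) (at t within {t0..})"
    and le: "\<And>t. t \<ge> t0 \<Longrightarrow> g' t \<le> - k * g t" and t: "t \<ge> t0"
  shows "g t \<le> g t0 * exp (- k * (t - t0))"
proof -
  have "g t * exp (k * t) \<le> g t0 * exp (k * t0)"
  proof (rule nonincreasing_half_line[OF has_derivative_exp_mult[OF g, where k = k], of t0 t])
    fix s assume "t0 < s" "s < t"
    then show "(g' s + k * g s) * exp (k * s) \<le> 0"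
      using le[of s] by (intro mult_nonpos_nonneg) auto
  qed (use t in auto)
  then show ?thesis by (simp add: exp_diff right_diff_distrib exp_minus field_simps)
qed

text \<open>Backward uniqueness at the equilibrium: a Lipschitz bound on \<open>g'\<close> is only needed while
  \<open>g\<close> is small, since \<open>g\<close> is nonincreasing.\<close>

lemma vanishes_backwards:
  fixes g g' :: "real \<Rightarrow> real"
  assumes g: "\<And>t. t \<ge> t0 \<Longrightarrow> (g has_real_derivative g' t) (at t within {t0..})"
    and nonneg: "\<And>t. t \<ge> t0 \<Longrightarrow> g t \<ge> 0" and le: "\<And>t. t \<ge> t0 \<Longrightarrow> g' t \<le> 0"
    and ge: "\<And>t. t \<ge> t0 \<Longrightarrow> g t \<le> \<delta> \<Longrightarrow> g' t \<ge> - k * g t" and \<delta>: "\<delta> > 0"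
    and ab: "t0 \<le> a" "a \<le> b" and b: "g b = 0"
  shows "g a = 0"
proof (rule ccontr)
  assume "g a \<noteq> 0"
  \<comment> \<open>A positive level that \<open>g\<close> attains between \<open>a\<close> and
    \<open>b\<close>. From that time \<open>r\<close> on \<open>g\<close> stays below
    \<open>\<delta>\<close>, where \<open>ge\<close> is available.\<close>
  define \<epsilon> where "\<epsilon> = min \<delta> (g a)"
  have \<epsilon>: "\<epsilon> > 0" using \<open>g a \<noteq> 0\<close> nonneg[OF ab(1)] \<delta> by (simp add: \<epsilon>_def)
  obtain r where r: "a \<le> r" "r \<le> b" "g r = \<epsilon>"
    using IVT2'[of g b \<epsilon> a] continuous_on_half_line[OF g ab(1)] ab b \<epsilon> by (auto simp: \<epsilon>_def)
  have small: "g t \<le> \<delta>" if "r \<le> t" for t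
  proof -
    have "g t \<le> g r"
      by (rule nonincreasing_half_line[OF g]) (use that r ab le in auto)
    then show ?thesis using r(3) by (simp add: \<epsilon>_def)
  qed
  \<comment> \<open>With the integrating factor \<open>g\<close> cannot decrease after
    \<open>r\<close>, hence cannot reach 0 at \<open>b\<close>.\<close>
  have "g r * exp (k * r) \<le> g b * exp (k * b)"
  proof (rule nondecreasing_half_line[OF has_derivative_exp_mult[OF g, where k = k], of r b])
    fix t assume "r < t" "t < b"
    then show "0 \<le> (g' t + k * g t) * exp (k * t)"
      using ge[of t] small[of t] r ab by (intro mult_nonneg_nonneg) auto
  qed (use r ab in auto)
  then show False using r(3) \<epsilon> b by (simp add: mult_le_0_iff)
qed

theorem theorem4p1:
  fixes n m :: nat and x y :: "complex mat" and \<rho> :: "real \<Rightarrow> complex mat" and t0 :: real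
  assumes n2: "n \<ge> 2" and m: "1 \<le> m" "m < n" "coprime m n"
    and x: "x \<in> carrier_mat n n" "hermitian x"
    and y: "y \<in> carrier_mat n n" "hermitian y"
    and u: "clock n (exp (2 * pi * \<i> * of_nat m / of_nat n)) = mexp_i (2 * pi / real n) x"
    and v: "shift n = mexp_i (2 * pi / real n) y"
    and dim: "\<And>t. t \<ge> t0 \<Longrightarrow> \<rho> t \<in> carrier_mat n n"
    and pos: "\<And>t. t \<ge> t0 \<Longrightarrow> strictly_positive (\<rho> t)"
    and init: "tr (\<rho> t0) = 1"
    and flow: "\<And>t i j. t \<ge> t0 \<Longrightarrow> i < n \<Longrightarrow> j < n \<Longrightarrow>
       ((\<lambda>s. \<rho> s $$ (i,j)) has_vector_derivative
          (- laplacian x y (mlog (\<rho> t))) $$ (i,j)) (at t within {t0..})"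
  shows "(\<forall>t\<ge>t0. \<rho> t = (1 / of_nat n) \<cdot>\<^sub>m 1\<^sub>m n) \<or>
         (strict_mono_on {t0..} (\<lambda>t. vn_entropy (\<rho> t)) \<and>
          ((\<lambda>t. vn_entropy (\<rho> t)) \<longlongrightarrow> ln (real n)) at_top)"
proof -
  have n: "n > 0" using n2 by simp
  define L where "L t = mlog (\<rho> t)" for t
  define D where "D t = laplacian x y (L t)" for t
  have L: "L t \<in> carrier_mat n n" if "t \<ge> t0" for t
    using strictly_positive_diagonalization[OF dim[OF that] pos[OF that]] unfolding L_def
    by (metis udiag_carrier)
  have D: "D t \<in> carrier_mat n n" if "t \<ge> t0" for t
    using L[OF that] x y by (simp add: D_def)
  have der: "((\<lambda>s. \<rho> s $$ (i,j)) has_vector_derivative (- D t) $$ (i,j)) (at t within {t0..})"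
    if "t \<ge> t0" "i < n" "j < n" for t i j
    using flow[OF that] by (simp add: D_def L_def)

  \<comment> \<open>The Laplacian is a sum of commutators, which are traceless, so the trace is
    constant along the flow.\<close>
  have tr1: "tr (\<rho> t) = 1" if t: "t \<ge> t0" for t
  proof -
    have "((\<lambda>s. tr (\<rho> s * 1\<^sub>m n)) has_vector_derivative 0) (at t within {t0..})" if t: "t \<ge> t0" for t
    proof -
      have "tr (- D t * 1\<^sub>m n) = - tr (D t)"
        using D[OF t] by (simp add: tr_uminus[of _ n])
      also have "tr (D t) = 0"
        using x y L[OF t] by (simp add: D_def laplacian_eq[of _ n] tr_add[of _ n] tr_comm[of _ n])
      finally show ?thesis
        using has_vector_derivative_tr_mult[of "{t0..}" \<rho> n t "- D t" "1\<^sub>m n"] dim D[OF t] der[OF t] t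
        by auto
    qed
    then obtain c where "\<And>t. t \<in> {t0..} \<Longrightarrow> tr (\<rho> t * 1\<^sub>m n) = c"
      using has_vector_derivative_zero_constant[of "{t0..}" "\<lambda>s. tr (\<rho> s * 1\<^sub>m n)"] by auto
    then have "tr (\<rho> t * 1\<^sub>m n) = tr (\<rho> t0 * 1\<^sub>m n)" using t by auto
    then show ?thesis using dim[OF t] dim[of t0] init by simp
  qed

  define f where "f t = hs (\<rho> t) - 1 / n" for t
  have f_nonneg: "f t \<ge> 0" if "t \<ge> t0" for t
    using density_hs_ge[OF n dim pos tr1] that by (simp add: f_def)
  define f' where "f' t = - 2 * Re (tr (\<rho> t * D t))" for t
  have f: "(f has_real_derivative f' t) (at t within {t0..})" if t: "t \<ge> t0" for t
  proof -
    have "adj (\<rho> t) = \<rho> t"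
      using pos[OF t] by (simp add: strictly_positive_def positive_mat_def hermitian_def)
    then have "((\<lambda>s. hs (\<rho> s)) has_real_derivative f' t) (at t within {t0..})"
      using has_real_derivative_hs[of "{t0..}" \<rho> n t "- D t"] dim D[OF t] der[OF t] t
      by (simp add: f'_def tr_uminus_mult[of _ n])
    then show ?thesis unfolding f_def by (auto intro!: derivative_eq_intros)
  qed
  obtain \<kappa> where \<kappa>: "\<kappa> > 0" and gap: "\<And>a. a \<in> carrier_mat n n \<Longrightarrow>
      \<kappa> * (hs a - (cmod (tr a))\<^sup>2 / n) \<le> hs (comm x a) + hs (comm y a)"
    using spectral_gap[OF n m(3) x y u v] n by auto
  \<comment> \<open>For trace 1 the distance to the scalars in \<open>gap\<close> is
    \<open>f\<close> itself.\<close>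
  have f_gap: "\<kappa> * f t \<le> hs (comm x (\<rho> t)) + hs (comm y (\<rho> t))" if "t \<ge> t0" for t
    using gap[OF dim[OF that]] tr1[OF that] by (simp add: f_def)
  have f'_eq: "f' t = - 2 * (Re (tr (\<rho> t * comm x (comm x (L t)))) + Re (tr (\<rho> t * comm y (comm y (L t)))))"
    if "t \<ge> t0" for t
    using tr_mult_laplacian[OF x(1) y(1) L[OF that] dim[OF that]] by (simp add: f'_def D_def)
  have f'_le: "f' t \<le> - (2 * \<kappa>) * f t" if t: "t \<ge> t0" for t
    using energy_bounds(2)[OF dim[OF t] pos[OF t] tr1[OF t] x] energy_bounds(2)[OF dim[OF t] pos[OF t] tr1[OF t] y]
      f_gap[OF t] by (simp add: f'_eq[OF t] L_def)
  \<comment> \<open>Twice the constant of the third energy bound, summed over \<open>x\<close> and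
    \<open>y\<close>.\<close>
  define k where "k = 16 * (real n)\<^sup>2 * (hs x + hs y)"
  have f'_ge: "f' t \<ge> - k * f t" if t: "t \<ge> t0" and small: "f t \<le> 1 / (4 * (real n)\<^sup>2)" for t
  proof -
    have "Re (tr (\<rho> t * comm z (comm z (L t)))) \<le> 8 * (real n)\<^sup>2 * hs z * f t"
      if "z \<in> carrier_mat n n" "hermitian z" for z
      using energy_bounds(3)[OF dim[OF t] pos[OF t] tr1[OF t] that n] small by (simp add: f_def L_def)
    from this[OF x] this[OF y] show ?thesis
      by (simp add: f'_eq[OF t] k_def algebra_simps)
  qed
  have f'_nonpos: "f' t \<le> 0" if t: "t \<ge> t0" for t
  proof -
    have "\<kappa> * f t \<ge> 0" using \<kappa> f_nonneg[OF t] by simp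
    then show ?thesis using f'_le[OF t] by simp
  qed

  have deficit: "vn_entropy (\<rho> t) \<le> ln n" "ln n - n * f t \<le> vn_entropy (\<rho> t)" if "t \<ge> t0" for t
    using entropy_deficit_bounds[OF n dim pos tr1] that by (auto simp: f_def algebra_simps)
  have lim: "((\<lambda>t. vn_entropy (\<rho> t)) \<longlongrightarrow> ln (real n)) at_top"
  proof (rule tendsto_sandwich[where f = "\<lambda>t. ln n - n * (f t0 * exp (- (2 * \<kappa>) * (t - t0)))" and h = "\<lambda>t. ln n"])
    show "\<forall>\<^sub>F t in at_top. ln n - n * (f t0 * exp (- (2 * \<kappa>) * (t - t0))) \<le> vn_entropy (\<rho> t)"
      using eventually_ge_at_top[of t0]
    proof eventually_elim
      case (elim t)
      have "n * f t \<le> n * (f t0 * exp (- (2 * \<kappa>) * (t - t0)))"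
        by (intro mult_left_mono exponential_decay[OF f f'_le elim]) auto
      then show ?case using deficit(2)[OF elim] by linarith
    qed
    show "\<forall>\<^sub>F t in at_top. vn_entropy (\<rho> t) \<le> ln n"
      using eventually_ge_at_top[of t0] by eventually_elim (rule deficit)
    have "((\<lambda>t. exp (- (2 * \<kappa>) * (t - t0))) \<longlongrightarrow> 0) at_top"
      using \<kappa> by real_asymp
    then have "((\<lambda>t. ln n - n * (f t0 * exp (- (2 * \<kappa>) * (t - t0)))) \<longlongrightarrow> ln n - n * (f t0 * 0)) at_top"
      by (intro tendsto_intros)
    then show "((\<lambda>t. ln n - n * (f t0 * exp (- (2 * \<kappa>) * (t - t0)))) \<longlongrightarrow> ln n) at_top" by simp
  qed auto

  define \<sigma> where "\<sigma> t = Re (tr (L t * D t))" for t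
  have S: "((\<lambda>s. vn_entropy (\<rho> s)) has_real_derivative \<sigma> t) (at t within {t0..})" if t: "t \<ge> t0" for t
  proof -
    \<comment> \<open>The logarithm is frozen at time \<open>t\<close>, so \<open>G\<close> is
      linear in the state and its derivative comes from the flow alone.\<close>
    define G where "G s = Re (tr (\<rho> s * L t))" for s
    have "((\<lambda>s. tr (\<rho> s * L t)) has_vector_derivative tr (- D t * L t)) (at t within {t0..})"
      by (rule has_vector_derivative_tr_mult) (use dim D[OF t] L[OF t] der[OF t] t in auto)
    then have "(G has_vector_derivative Re (tr (- D t * L t))) (at t within {t0..})"
      unfolding G_def by (rule bounded_linear.has_vector_derivative[OF bounded_linear_Re])
    also have "Re (tr (- D t * L t)) = - \<sigma> t"
      unfolding tr_uminus_mult(1)[OF D[OF t] L[OF t]] tr_mult_comm[OF D[OF t] L[OF t]] by (simp add: \<sigma>_def)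
    finally have G: "(G has_real_derivative - \<sigma> t) (at t within {t0..})"
      by (simp add: has_real_derivative_iff_has_vector_derivative)
    obtain C where C: "\<And>B. B \<in> carrier_mat n n \<Longrightarrow> strictly_positive B \<Longrightarrow> tr B = 1 \<Longrightarrow>
        \<bar>vn_entropy (\<rho> t) - vn_entropy B - Re (tr ((B - \<rho> t) * L t))\<bar> \<le> C * hs (B - \<rho> t)"
      using entropy_taylor[OF dim[OF t] pos[OF t] tr1[OF t]] unfolding L_def by blast
    \<comment> \<open>By \<open>entropy_taylor\<close> this sum deviates from its value at
      \<open>t\<close> by at most a multiple of \<open>hs (\<rho> s - \<rho> t)\<close>, which
      vanishes to second order there. Hence \<open>S' = - G'\<close>, which is
      \<open>\<sigma> t\<close>.\<close>
    have "((\<lambda>s. vn_entropy (\<rho> s) + G s) has_real_derivative 0) (at t within {t0..})"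
    proof (rule has_derivative_of_small_remainder[where h = "\<lambda>s. hs (\<rho> s - \<rho> t)"])
      fix s assume "s \<in> {t0..}"
      then have s: "s \<ge> t0" by simp
      have "Re (tr ((\<rho> s - \<rho> t) * L t)) = G s - G t"
        using dim[OF s] dim[OF t] L[OF t]
        by (simp add: G_def minus_mult_distrib_mat[of _ n n _ _ n] tr_diff[of _ n] mult_carrier_mat[of _ n n _ n])
      then show "\<bar>(vn_entropy (\<rho> s) + G s) - (vn_entropy (\<rho> t) + G t)\<bar> \<le> C * hs (\<rho> s - \<rho> t)"
        using C[OF dim[OF s] pos[OF s] tr1[OF s]] by linarith
    next
      have zero: "\<rho> t - \<rho> t = 0\<^sub>m n n" using dim[OF t] by simp
      then show "hs (\<rho> t - \<rho> t) = 0" by (simp add: hs_def)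
      have "((\<lambda>s. hs (\<rho> s - \<rho> t)) has_real_derivative 2 * Re (tr (adj (\<rho> t - \<rho> t) * - D t))) (at t within {t0..})"
      proof (rule has_real_derivative_hs)
        fix i j assume ij: "i < n" "j < n"
        have "((\<lambda>s. \<rho> s $$ (i,j) - \<rho> t $$ (i,j)) has_vector_derivative (- D t) $$ (i,j) - 0) (at t within {t0..})"
          by (intro has_vector_derivative_diff der[OF t ij] has_vector_derivative_const)
        then show "((\<lambda>s. (\<rho> s - \<rho> t) $$ (i,j)) has_vector_derivative (- D t) $$ (i,j)) (at t within {t0..})"
          using dim[OF t] ij by simp
      qed (use dim D[OF t] t in \<open>auto simp: minus_carrier_mat\<close>)
      moreover have "adj (0\<^sub>m n n) = 0\<^sub>m n n" by (intro eq_matI) auto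
      then have "tr (adj (\<rho> t - \<rho> t) * - D t) = 0"
        using D[OF t] by (simp add: zero left_mult_zero_mat[of _ n n]) (simp add: tr_def)
      ultimately show "((\<lambda>s. hs (\<rho> s - \<rho> t)) has_real_derivative 0) (at t within {t0..})" by simp
    qed (use t in auto)
    from DERIV_diff[OF this G] show ?thesis by simp
  qed
  have \<sigma>_ge: "\<sigma> t \<ge> \<kappa> * f t" if t: "t \<ge> t0" for t
    using energy_bounds(1)[OF dim[OF t] pos[OF t] tr1[OF t] x] energy_bounds(1)[OF dim[OF t] pos[OF t] tr1[OF t] y]
      f_gap[OF t] tr_mult_laplacian[OF x(1) y(1) L[OF t] L[OF t]] by (simp add: \<sigma>_def D_def L_def)

  show ?thesis
  \<comment> \<open>A zero of \<open>f\<close> spreads forward by monotonicity and backward by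
    \<open>vanishes_backwards\<close>, which makes the solution stationary. Without zeros
    \<open>\<sigma>\<close> is positive everywhere.\<close>
  proof (cases "\<exists>b\<ge>t0. f b = 0")
    case True
    then obtain b where b: "b \<ge> t0" "f b = 0" by blast
    have "f t = 0" if t: "t \<ge> t0" for t
    proof (cases "t \<le> b")
      case True
      show ?thesis
        by (rule vanishes_backwards[OF f f_nonneg f'_nonpos f'_ge _ t True b(2)]) (use n in auto)
    next
      case False
      then have "f t \<le> f b"
        using b f'_nonpos by (intro nonincreasing_half_line[OF f]) auto
      then show ?thesis using b f_nonneg[OF t] by simp
    qed
    then show ?thesis
      using density_hs_eq_imp_maximally_mixed[OF n dim pos tr1] by (simp add: f_def)
  next
    case False
    then have "\<sigma> t > 0" if t: "t \<ge> t0" for t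
      using \<sigma>_ge[OF t] f_nonneg[OF t] \<kappa> t mult_pos_pos[of \<kappa> "f t"]
      by (metis less_eq_real_def less_le_trans)
    then have "strict_mono_on {t0..} (\<lambda>t. vn_entropy (\<rho> t))"
      by (intro strict_mono_onI increasing_half_line[OF S]) auto
    then show ?thesis using lim by blast
  qed
qed

end
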